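(* Let $G$ be a finite simple graph and $S\subseteq V(G)$ such that $G\cup W(S)$ is a vertex decomposable graph. If $\mathcal{B}_{(G\setminus S)\setminus N_{G\setminus S}[A]}$ is not vertex decomposable for some independent set $A$ of $G\setminus S$, then for every $k\ge 2$ the ideal $J(G\cup W(S))^{(k)}$ is not componentwise linear.
   Context: Graphs are finite, simple, undirected. For $A\subseteq V(G)$, $N_G(A)$ is the set of vertices adjacent to some vertex of $A$, and $N_G[A]=N_G(A)\cup A$ (so $N_G[\emptyset]=\emptyset$); $G\setminus U$ is the induced subgraph on $V(G)\setminus U$. For $S\subseteq V(G)$, $G\cup W(S)$ is the graph with vertex set $V(G)\cup\{z_x : x\in S\}$ (the $z_x$ being new distinct vertices) and edge set $E(G)\cup\{\{x,z_x\}: x\in S\}$ (a whisker is added at each vertex of $S$). Cover ideals. For a graph $H$ with vertex set $\{x_1,\dots,x_n\}$, in $R=\mathbb{K}[x_1,\dots,x_n]$, $\mathbb{K}$ a field, the cover ideal is $J(H)=\bigcap_{\{x_i,x_j\}\in E(H)}(x_i,x_j)$, and its $k$-th symbolic power is $J(H)^{(k)}=\bigcap_{\{x_i,x_j\}\in E(H)}(x_i,x_j)^k$. A homogeneous ideal $I$ is componentwise linear if for each $\ell$ the ideal generated by all degree $\ell$ elements of $I$ has a linear resolution. Vertex decomposability. A vertex $x$ of $H$ is a shedding vertex if no independent set of $H\setminus N_H[x]$ is a maximal independent set of $H\setminus x$. $H$ is (recursively) vertex decomposable if it has no edges, or it has a shedding vertex $x$ such that $H\setminus x$ and $H\setminus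 N_H[x]$ are both vertex decomposable. If $H$ is vertex decomposable, then so is $H\setminus N_H[A]$ for every independent set $A$ of $H$ (known); in particular, if $G\cup W(S)$ is vertex decomposable then so are $G\setminus S$ and all $(G\setminus S)\setminus N_{G\setminus S}[A]$. The graph $\mathcal{B}_H$. Let $H$ be a vertex decomposable graph. A shedding order of $H$ is a sequence $(a_1,\dots,a_l)$ of vertices such that $a_1$ is a shedding vertex of $H$, $a_i$ is a shedding vertex of $H\setminus\{a_1,\dots,a_{i-1}\}$ for $1<i\le l$, and $H\setminus\{a_1,\dots,a_l\}$ has no edges; the remaining vertices $\{b_1,\dots,b_r\}=V(H)\setminus\{a_1,\dots,a_l\}$ form the corresponding $i$-order. Given such a shedding order, $\mathcal{B}_H$ is the spanning bipartite subgraph of $H$ with vertex set $V(H)=\{b_1,\dots,b_r\}\sqcup\{a_1,\dots,a_l\}$ and edge set $\{\{b_i,a_j\}\in E(H): 1\le i\le r,\ 1\le j\le l\}$. For each vertex decomposable graph $H$ one (arbitrary) shedding order is fixed and $\mathcal{B}_H$ is formed from it. *)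

theory Defs
  imports
    "Jordan_Normal_Form.Matrix"
    "HOL-Algebra.Ideal_Product"
    "HOL-Library.Poly_Mapping"
begin

section \<open>Graphs\<close>

record 'v sgraph =
  verts :: "'v set"
  edges :: "'v set set"

definition simple_graph :: "'v sgraph \<Rightarrow> bool" where
  "simple_graph G \<longleftrightarrow> finite (verts G) \<and> (\<forall>e\<in>edges G. e \<subseteq> verts G \<and> card e = 2)"

definition del_verts :: "'v sgraph \<Rightarrow> 'v set \<Rightarrow> 'v sgraph" where
  "del_verts G U = \<lparr> verts = verts G - U, edges = {e \<in> edges G. e \<subseteq> verts G - U} \<rparr>"

definition nbhd :: "'v sgraph \<Rightarrow> 'v set \<Rightarrow> 'v set" where
  "nbhd G A = {v \<in> verts G. \<exists>a\<in>A. {a, v} \<in> edges G}"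

definition closed_nbhd :: "'v sgraph \<Rightarrow> 'v set \<Rightarrow> 'v set" where
  "closed_nbhd G A = nbhd G A \<union> A"

text \<open>The vertex \<open>x\<close> of \<open>G\<close> becomes \<open>Inl x\<close>, and \<open>Inr x\<close> is the new whisker vertex \<open>z\<^sub>x\<close>.\<close>

definition add_whiskers :: "'v sgraph \<Rightarrow> 'v set \<Rightarrow> ('v + 'v) sgraph" where
  "add_whiskers G S =
     \<lparr> verts = Inl ` verts G \<union> Inr ` S,
       edges = (\<lambda>e. Inl ` e) ` edges G \<union> (\<lambda>x. {Inl x, Inr x}) ` S \<rparr>"

definition indep_set :: "'v sgraph \<Rightarrow> 'v set \<Rightarrow> bool" where
  "indep_set G A \<longleftrightarrow> A \<subseteq> verts G \<and> (\<forall>e\<in>edges G. \<not> e \<subseteq> A)"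

definition max_indep_set :: "'v sgraph \<Rightarrow> 'v set \<Rightarrow> bool" where
  "max_indep_set G A \<longleftrightarrow> indep_set G A \<and> (\<forall>B. indep_set G B \<longrightarrow> A \<subseteq> B \<longrightarrow> B = A)"

definition shedding_vertex :: "'v sgraph \<Rightarrow> 'v \<Rightarrow> bool" where
  "shedding_vertex G x \<longleftrightarrow> x \<in> verts G \<and>
     (\<forall>A. indep_set (del_verts G (closed_nbhd G {x})) A \<longrightarrow> \<not> max_indep_set (del_verts G {x}) A)"

inductive vertex_decomposable :: "'v sgraph \<Rightarrow> bool" where
  no_edges: "edges G = {} \<Longrightarrow> vertex_decomposable G"
| shed: "shedding_vertex G x \<Longrightarrow> vertex_decomposable (del_verts G {x}) \<Longrightarrow>
    vertex_decomposable (del_verts G (closed_nbhd G {x})) \<Longrightarrow> vertex_decomposable G"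

definition shedding_order :: "'v sgraph \<Rightarrow> 'v list \<Rightarrow> bool" where
  "shedding_order H as \<longleftrightarrow>
     (\<forall>i<length as. shedding_vertex (del_verts H (set (take i as))) (as ! i)) \<and>
     edges (del_verts H (set as)) = {}"

lemma del_verts_empty: "simple_graph G \<Longrightarrow> del_verts G {} = G"
  by (cases G) (auto simp: simple_graph_def del_verts_def)

lemma del_verts_del_verts: "del_verts (del_verts G A) B = del_verts G (A \<union> B)"
  by (auto simp: del_verts_def)

lemma simple_graph_del_verts: "simple_graph G \<Longrightarrow> simple_graph (del_verts G A)"
  by (auto simp: simple_graph_def del_verts_def)

lemma shedding_order_exists:
  assumes "vertex_decomposable H" "simple_graph H"
  shows "\<exists>as. shedding_order H as"
  using assms
proof (induction rule: vertex_decomposable.induct)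
  case (no_edges G)
  then have "shedding_order G []"
    by (simp add: shedding_order_def del_verts_empty)
  then show ?case ..
next
  case (shed G x)
  then obtain as where as: "shedding_order (del_verts G {x}) as"
    using simple_graph_del_verts by blast
  have "shedding_vertex (del_verts G (set (take i (x # as)))) ((x # as) ! i)"
    if "i < length (x # as)" for i
    using that as shed(1,6)
    by (cases i) (auto simp: shedding_order_def del_verts_empty del_verts_del_verts)
  then have "shedding_order G (x # as)"
    using as by (simp add: shedding_order_def del_verts_del_verts)
  then show ?case ..
qed

text \<open>The bipartite graph \<open>\<B>\<^sub>H\<close> formed from the shedding order \<open>as\<close>.\<close>

definition bip_graph :: "'v sgraph \<Rightarrow> 'v list \<Rightarrow> 'v sgraph" where
  "bip_graph H as =
     \<lparr> verts = verts H,
       edges = {e \<in> edges H. \<exists>b \<in> verts H - set as. \<exists>a \<in> set as. e = {b, a}} \<rparr>"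


section \<open>The polynomial ring on a set of variables\<close>

type_synonym ('v, 'k) mpoly = "('v \<Rightarrow>\<^sub>0 nat) \<Rightarrow>\<^sub>0 'k"

definition polys :: "'v set \<Rightarrow> ('v, 'k::field) mpoly set" where
  "polys V = {p. \<forall>m \<in> Poly_Mapping.keys p. Poly_Mapping.keys m \<subseteq> V}"

definition poly_ring :: "'v set \<Rightarrow> ('v, 'k::field) mpoly ring" where
  "poly_ring V = \<lparr> carrier = polys V, mult = (*), one = 1, zero = 0, add = (+) \<rparr>"

definition var :: "'v \<Rightarrow> ('v, 'k::field) mpoly" where
  "var v = Poly_Mapping.single (Poly_Mapping.single v 1) 1"

definition mdeg :: "('v \<Rightarrow>\<^sub>0 nat) \<Rightarrow> nat" where
  "mdeg m = (\<Sum>v\<in>Poly_Mapping.keys m. Poly_Mapping.lookup m v)"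

text \<open>The zero polynomial is homogeneous of every degree.\<close>

definition homogeneous :: "nat \<Rightarrow> ('v, 'k::field) mpoly \<Rightarrow> bool" where
  "homogeneous d p \<longleftrightarrow> (\<forall>m \<in> Poly_Mapping.keys p. mdeg m = d)"

lemma polys_zero: "0 \<in> polys V" and polys_one: "1 \<in> polys V"
  by (auto simp: polys_def)

lemma polys_add: "p \<in> polys V \<Longrightarrow> q \<in> polys V \<Longrightarrow> p + q \<in> polys V"
  unfolding polys_def using keys_add[of p q] by blast

lemma polys_uminus: "p \<in> polys V \<Longrightarrow> - p \<in> polys V"
  by (auto simp: polys_def in_keys_iff)

lemma polys_mult:
  assumes "p \<in> polys V" "q \<in> polys V" shows "p * q \<in> polys V"
  unfolding polys_def
proof (safe)
  fix m x assume "m \<in> Poly_Mapping.keys (p * q)" "x \<in> Poly_Mapping.keys m"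
  then obtain a b where "a \<in> Poly_Mapping.keys p" "b \<in> Poly_Mapping.keys q" "m = a + b"
    using keys_mult[of p q] by blast
  then show "x \<in> V"
    using assms keys_add[of a b] \<open>x \<in> Poly_Mapping.keys m\<close> unfolding polys_def by blast
qed

lemma cring_poly_ring: "cring (poly_ring V)"
proof (rule cringI)
  show "abelian_group (poly_ring V :: ('a, 'b::field) mpoly ring)"
  proof (rule abelian_groupI)
    fix p :: "('a, 'b) mpoly" assume "p \<in> carrier (poly_ring V)"
    then show "\<exists>y\<in>carrier (poly_ring V). y \<oplus>\<^bsub>poly_ring V\<^esub> p = \<zero>\<^bsub>poly_ring V\<^esub>"
      by (intro bexI[of _ "- p"]) (auto simp: poly_ring_def polys_uminus)
  qed (auto simp: poly_ring_def polys_zero polys_add algebra_simps)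
  show "comm_monoid (poly_ring V :: ('a, 'b::field) mpoly ring)"
    by (rule comm_monoidI) (auto simp: poly_ring_def polys_one polys_mult algebra_simps)
qed (auto simp: poly_ring_def algebra_simps)


section \<open>Graded free resolutions and componentwise linearity\<close>

text \<open>
  A graded free resolution
  \<open>\<dots> \<rightarrow> F\<^sub>2 \<rightarrow> F\<^sub>1 \<rightarrow> F\<^sub>0 \<rightarrow> I \<rightarrow> 0\<close> with \<open>F\<^sub>i\<close> of rank \<open>r i\<close> and with its
  \<open>j\<close>-th basis vector in degree \<open>s i j\<close> is given by matrices: \<open>D 0\<close> is the row of generators of
  \<open>I\<close>, and \<open>D (Suc i)\<close> is the map from \<open>F\<^sub>i\<^sub>+\<^sub>1\<close> to \<open>F\<^sub>i\<close>, acting on column vectors.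
  The degree conditions are written additively, so that an entry whose degree would have to be
  negative is forced to be zero. The resolution is minimal if the entries of all \<open>D (Suc i)\<close> lie in
  the maximal ideal generated by the variables, i.e. have no constant term. Degrees in \<open>nat\<close>
  suffice, because a minimal resolution of an ideal only has shifts of this kind.
\<close>

definition free_mod :: "'v set \<Rightarrow> nat \<Rightarrow> ('v, 'k::field) mpoly vec set" where
  "free_mod V n = {u \<in> carrier_vec n. \<forall>j<n. u $ j \<in> polys V}"

definition minimal_graded_free_resolution ::
  "'v set \<Rightarrow> ('v, 'k::field) mpoly set \<Rightarrow> (nat \<Rightarrow> nat) \<Rightarrow> (nat \<Rightarrow> nat \<Rightarrow> nat) \<Rightarrow>
   (nat \<Rightarrow> ('v, 'k) mpoly mat) \<Rightarrow> bool" where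
  "minimal_graded_free_resolution V I r s D \<longleftrightarrow>
     \<comment> \<open>format and entries\<close>
     D 0 \<in> carrier_mat 1 (r 0) \<and>
     (\<forall>i. D (Suc i) \<in> carrier_mat (r i) (r (Suc i))) \<and>
     (\<forall>i. elements_mat (D i) \<subseteq> polys V) \<and>
     \<comment> \<open>the maps are homogeneous of degree zero\<close>
     (\<forall>j<r 0. homogeneous (s 0 j) (D 0 $$ (0, j))) \<and>
     (\<forall>i. \<forall>t<r i. \<forall>j<r (Suc i). \<forall>m \<in> Poly_Mapping.keys (D (Suc i) $$ (t, j)). mdeg m + s i t = s (Suc i) j) \<and>
     \<comment> \<open>exactness\<close>
     (\<lambda>u. (D 0 *\<^sub>v u) $ 0) ` free_mod V (r 0) = I \<and>
     {u \<in> free_mod V (r 0). D 0 *\<^sub>v u = 0\<^sub>v 1} = (\<lambda>w. D 1 *\<^sub>v w) ` free_mod V (r 1) \<and>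
     (\<forall>i. {u \<in> free_mod V (r (Suc i)). D (Suc i) *\<^sub>v u = 0\<^sub>v (r i)} =
          (\<lambda>w. D (Suc (Suc i)) *\<^sub>v w) ` free_mod V (r (Suc (Suc i)))) \<and>
     \<comment> \<open>minimality\<close>
     (\<forall>i. \<forall>p \<in> elements_mat (D (Suc i)). Poly_Mapping.lookup p 0 = 0)"

text \<open>Linear means \<open>F\<^sub>i = R(-d-i)\<^bsup>r i\<^esup>\<close> for all \<open>i\<close>. The zero ideal qualifies, with all ranks zero.\<close>

definition has_linear_resolution :: "'v set \<Rightarrow> ('v, 'k::field) mpoly set \<Rightarrow> bool" where
  "has_linear_resolution V I \<longleftrightarrow>
     (\<exists>d r s D. minimal_graded_free_resolution V I r s D \<and> (\<forall>i. \<forall>j<r i. s i j = d + i))"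

text \<open>Meant for homogeneous ideals \<open>I\<close>; homogeneity is not made part of the predicate.\<close>

definition componentwise_linear :: "'v set \<Rightarrow> ('v, 'k::field) mpoly set \<Rightarrow> bool" where
  "componentwise_linear V I \<longleftrightarrow>
     (\<forall>l. has_linear_resolution V (Idl\<^bsub>poly_ring V\<^esub> {f \<in> I. homogeneous l f}))"


section \<open>Symbolic powers of cover ideals\<close>

text \<open>
  Powers of ideals are powers in the multiplicative monoid of ideals. Intersecting with the ring
  only matters for a graph without edges, where the intersection of ideals is empty.
\<close>

definition cover_ideal_symbolic_power :: "'v sgraph \<Rightarrow> nat \<Rightarrow> ('v, 'k::field) mpoly set" where
  "cover_ideal_symbolic_power H k =
     (let R = poly_ring (verts H) in
      carrier R \<inter> (\<Inter>e \<in> edges H. (Idl\<^bsub>R\<^esub> (var ` e)) [^]\<^bsub>ideals_set R\<^esub> k))"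

end

theory Submission
  imports Defs
begin

text \<open>
  Linearity of the first syzygies of the component of degree \<open>d\<close> has a combinatorial shadow: for two
  monomials \<open>u \<noteq> v\<close> of degree \<open>d\<close> in the ideal, some variable \<open>y\<close> with \<open>deg\<^sub>y u < deg\<^sub>y v\<close> can be
  exchanged against a variable \<open>x\<close> so that \<open>u y / x\<close> is again in the ideal.

  Write \<open>H = (G - S) - N[A]\<close> as \<open>P \<union> Q\<close>, with \<open>P\<close> the shedding order and \<open>Q\<close> the \<open>i\<close>-order; every
  vertex of \<open>P\<close> has a neighbour in \<open>Q\<close>. Consider exponent vectors of \<open>J(G \<union> W(S))\<^sup>(\<^sup>k\<^sup>)\<close> which
  vanish on the whisker vertices and on \<open>A\<close> and are at most \<open>1\<close> on \<open>Q\<close>. They are at least \<open>k - 1\<close>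
  on \<open>P\<close>, so the edges inside \<open>P\<close> impose no condition (as \<open>k \<ge> 2\<close>), and what remains are the vertex
  covers of \<open>\<B>\<^sub>H\<close>. The exchange property, applied to the covers of a link of \<open>\<B>\<^sub>H\<close> by its two sides
  (padded to equal degree), yields a leaf in every link that has an edge. The neighbour of a leaf
  is a shedding vertex, so \<open>\<B>\<^sub>H\<close> would be vertex decomposable.
\<close>

abbreviation "keys \<equiv> Poly_Mapping.keys"
abbreviation "lookup \<equiv> Poly_Mapping.lookup"
abbreviation "single \<equiv> Poly_Mapping.single"

section \<open>Monomial ideals\<close>

lemma mdeg_eq_sum:
  assumes "finite V" "keys m \<subseteq> V"
  shows "mdeg m = (\<Sum>x\<in>V. lookup m x)"
  unfolding mdeg_def using assms by (intro sum.mono_neutral_left) (auto simp: in_keys_iff)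

lemma mdeg_add: "mdeg (m + n) = mdeg m + mdeg n"
proof -
  let ?V = "keys m \<union> keys n"
  have "mdeg (m + n) = (\<Sum>x\<in>?V. lookup (m + n) x)"
    using keys_add[of m n] by (intro mdeg_eq_sum) auto
  also have "\<dots> = (\<Sum>x\<in>?V. lookup m x) + (\<Sum>x\<in>?V. lookup n x)"
    by (simp add: lookup_add sum.distrib)
  also have "\<dots> = mdeg m + mdeg n"
    by (subst (1 2) mdeg_eq_sum[of ?V]) auto
  finally show ?thesis .
qed

lemma mdeg_eq_0_iff: "mdeg m = 0 \<longleftrightarrow> m = 0"
  by (auto simp: mdeg_def in_keys_iff intro: poly_mapping_eqI)

lemma mdeg_eq_1D:
  assumes "mdeg m = 1"
  obtains x where "m = single x 1"
proof -
  have "(\<Sum>x\<in>keys m. lookup m x) = Suc 0"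
    using assms by (simp add: mdeg_def)
  then obtain x where x: "lookup m x = 1" "\<forall>y\<in>keys m. y \<noteq> x \<longrightarrow> lookup m y = 0"
    by (auto simp: sum_eq_Suc0_iff)
  have "m = single x 1"
  proof (rule poly_mapping_eqI)
    fix y show "lookup m y = lookup (single x 1) y"
      using x by (cases "y = x") (auto simp: lookup_single in_keys_iff)
  qed
  then show ?thesis by (rule that)
qed

section \<open>Coefficients of products of polynomials\<close>

lemma sum_single_keys: "(\<Sum>m\<in>keys p. single m (lookup p m)) = p"
  by (rule poly_mapping_eqI) (auto simp: lookup_sum lookup_single when_def in_keys_iff)

lemma lookup_mult_keys:
  fixes p q :: "('v, 'k::field) mpoly"
  shows "lookup (p * q) m = (\<Sum>a\<in>keys p. \<Sum>b\<in>keys q. if a + b = m then lookup p a * lookup q b else 0)"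
proof -
  have "p * q = (\<Sum>a\<in>keys p. single a (lookup p a)) * (\<Sum>b\<in>keys q. single b (lookup q b))"
    by (simp only: sum_single_keys)
  also have "\<dots> = (\<Sum>a\<in>keys p. \<Sum>b\<in>keys q. single (a + b) (lookup p a * lookup q b))"
    by (simp add: sum_product mult_single)
  finally show ?thesis
    by (simp add: lookup_sum lookup_single when_def)
qed

lemma lookup_monomial_mult:
  fixes p :: "('v, 'k::field) mpoly"
  shows "lookup (single a 1 * p) (a + m) = lookup p m"
proof -
  have "lookup (single a 1 * p) (a + m)
      = (\<Sum>x\<in>{a}. \<Sum>b\<in>keys p. if x + b = a + m then lookup (single a (1::'k)) x * lookup p b else 0)"
    by (simp only: lookup_mult_keys keys_single one_neq_zero if_False)
  also have "\<dots> = (\<Sum>b\<in>keys p. if b = m then lookup p b else 0)"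
    by simp
  finally show ?thesis by (simp add: in_keys_iff)
qed

lemma lookup_monomial_mult_eq_0:
  fixes p :: "('v, 'k::field) mpoly"
  assumes "\<And>b. a + b \<noteq> m"
  shows "lookup (single a 1 * p) m = 0"
  using assms by (auto simp: lookup_mult_keys)

text \<open>Degrees add under multiplication, so a term of \<open>q\<close> that takes part in
  reaching \<open>m\<close> has degree zero and is the constant term.\<close>

lemma lookup_mult_top:
  fixes p q :: "('v, 'k::field) mpoly"
  assumes "\<forall>a\<in>keys p. mdeg a = mdeg m"
  shows "lookup (p * q) m = lookup p m * lookup q 0"
proof -
  have "a = m \<and> b = 0" if "a \<in> keys p" "a + b = m" for a b
  proof -
    have "mdeg b = 0" using that assms mdeg_add[of a b] by auto
    then show ?thesis using that by (simp add: mdeg_eq_0_iff)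
  qed
  then have "lookup (p * q) m = (\<Sum>a\<in>keys p. \<Sum>b\<in>keys q. if a = m \<and> b = 0 then lookup p m * lookup q 0 else 0)"
    unfolding lookup_mult_keys by (intro sum.cong refl) auto
  also have "\<dots> = (\<Sum>a\<in>keys p. if a = m then lookup p m * lookup q 0 else 0)"
    by (intro sum.cong refl) (auto simp: in_keys_iff)
  finally show ?thesis by (auto simp: in_keys_iff)
qed

text \<open>Each term of a linear form is a single variable, and \<open>m\<close> can be reached
  from it only if that variable occurs in \<open>m\<close>. Summing over \<open>keys m\<close>
  therefore makes the truncated subtraction in \<open>m - single x 1\<close> a genuine one.\<close>

lemma lookup_linear_mult:
  fixes p q :: "('v, 'k::field) mpoly"
  assumes "\<forall>a\<in>keys p. mdeg a = 1"
  shows "lookup (p * q) m = (\<Sum>x\<in>keys m. lookup p (single x 1) * lookup q (m - single x 1))"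
proof -
  define g where "g a = (\<Sum>b\<in>keys q. if a + b = m then lookup p a * lookup q b else 0)" for a
    have 1: "g (single x 1) = lookup p (single x 1) * lookup q (m - single x 1)" if "x \<in> keys m" for x
  proof -
    have "single x 1 + (m - single x 1) = m"
    proof (rule poly_mapping_eqI)
      fix y
      have "lookup m x \<ge> 1" using that by (simp add: in_keys_iff)
      then show "lookup (single x 1 + (m - single x 1)) y = lookup m y"
        by (cases "y = x") (simp_all add: lookup_add lookup_minus lookup_single)
    qed
    then have "single x 1 + b = m \<longleftrightarrow> b = m - single x 1" for b
      by (metis add_diff_cancel_left')
    then have "g (single x 1) = (\<Sum>b\<in>keys q. if b = m - single x 1 then lookup p (single x 1) * lookup q b else 0)"
      unfolding g_def by (simp only:)
    also have "\<dots> = (if m - single x 1 \<in> keys q then lookup p (single x 1) * lookup q (m - single x 1) else 0)"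
      by (simp only: sum.delta finite_keys)
    also have "\<dots> = lookup p (single x 1) * lookup q (m - single x 1)"
      by (metis in_keys_iff mult_zero_right)
    finally show ?thesis .
  qed
  have 2: "g a = 0" if a: "a \<in> keys p" "a \<notin> (\<lambda>x. single x 1) ` keys m" for a
  proof -
    obtain x where "a = single x 1" using assms a(1) mdeg_eq_1D by metis
    with a(2) have "lookup a x = 1" "lookup m x = 0" by (auto simp: in_keys_iff)
    then have "a + b \<noteq> m" for b
      by (metis add_is_0 lookup_add one_neq_zero)
    then show ?thesis by (simp add: g_def)
  qed
  have 3: "g a = 0" if "a \<notin> keys p" for a
    using that unfolding g_def by (intro sum.neutral) (simp add: in_keys_iff)
  have "lookup (p * q) m = sum g (keys p)"
    by (simp add: lookup_mult_keys g_def)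
  also have "\<dots> = sum g ((\<lambda>x. single x 1) ` keys m)"
    using 2 3 by (intro sum.mono_neutral_cong) auto
  also have "\<dots> = (\<Sum>x\<in>keys m. g (single x 1))"
    by (subst sum.reindex) (auto simp: inj_on_def poly_mapping_eq_iff fun_eq_iff lookup_single when_def)
  finally show ?thesis using 1 by simp
qed

section \<open>Monomial ideals and symbolic powers as sets of exponents\<close>

definition monomial_ideal :: "'v set \<Rightarrow> ('v \<Rightarrow>\<^sub>0 nat) set \<Rightarrow> ('v, 'k::field) mpoly set" where
  "monomial_ideal V M = {p \<in> polys V. keys p \<subseteq> M}"

lemma polys_single: "keys m \<subseteq> V \<Longrightarrow> single m c \<in> polys V"
  by (auto simp: polys_def)

lemma ring_poly_ring: "ring (poly_ring V)"
  using cring_poly_ring by (rule cring.axioms(1))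

lemma a_inv_poly_ring:
  fixes p :: "('v, 'k::field) mpoly"
  assumes "p \<in> polys V"
  shows "\<ominus>\<^bsub>poly_ring V\<^esub> p = - p"
proof -
  interpret cring "poly_ring V :: ('v, 'k) mpoly ring" by (rule cring_poly_ring)
  show ?thesis
    by (rule minus_equality) (use assms in \<open>auto simp: poly_ring_def polys_uminus\<close>)
qed

lemma ideal_monomial_ideal:
  fixes V :: "'v set"
  assumes M: "\<And>m n. m \<in> M \<Longrightarrow> m + n \<in> M"
  shows "ideal (monomial_ideal V M :: ('v, 'k::field) mpoly set) (poly_ring V)"
proof (rule idealI)
  show "ring (poly_ring V :: ('v, 'k) mpoly ring)" by (rule ring_poly_ring)
  have mult: "x * p \<in> monomial_ideal V M" if "p \<in> monomial_ideal V M" "x \<in> polys V"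
    for p x :: "('v, 'k) mpoly"
  proof -
    have "m \<in> M" if m: "m \<in> keys (x * p)" for m
    proof -
      obtain a b where "b \<in> keys p" "m = a + b"
        using keys_mult[of x p] m by blast
      then show ?thesis
        using M[of b a] \<open>p \<in> monomial_ideal V M\<close> by (auto simp: monomial_ideal_def add.commute)
    qed
    then show ?thesis
      using that by (auto simp: monomial_ideal_def polys_mult)
  qed
  show "subgroup (monomial_ideal V M :: ('v, 'k) mpoly set) (add_monoid (poly_ring V))"
  proof
    fix p q :: "('v, 'k) mpoly"
    assume pq: "p \<in> monomial_ideal V M" "q \<in> monomial_ideal V M"
    show "p \<otimes>\<^bsub>add_monoid (poly_ring V)\<^esub> q \<in> monomial_ideal V M"
      using pq keys_add[of p q] by (auto simp: monomial_ideal_def poly_ring_def polys_add)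
    have "inv\<^bsub>add_monoid (poly_ring V)\<^esub> p = - p"
      using a_inv_poly_ring[of p V] pq by (simp add: a_inv_def monomial_ideal_def)
    then show "inv\<^bsub>add_monoid (poly_ring V)\<^esub> p \<in> monomial_ideal V M"
      using pq by (simp add: monomial_ideal_def polys_uminus subset_iff in_keys_iff)
  qed (auto simp: monomial_ideal_def poly_ring_def polys_zero)
  fix p x :: "('v, 'k) mpoly"
  assume "p \<in> monomial_ideal V M" "x \<in> carrier (poly_ring V)"
  then show "x \<otimes>\<^bsub>poly_ring V\<^esub> p \<in> monomial_ideal V M" "p \<otimes>\<^bsub>poly_ring V\<^esub> x \<in> monomial_ideal V M"
    using mult[of p x] by (auto simp: poly_ring_def mult.commute)
qed

text \<open>A polynomial is the sum of its terms, and each term is a monomial times a constant of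
  the ring, so it suffices to test monomials.\<close>

lemma monomial_ideal_subset:
  fixes V :: "'v set"
  assumes I: "ideal (I :: ('v, 'k::field) mpoly set) (poly_ring V)"
    and mono: "\<And>m. m \<in> M \<Longrightarrow> keys m \<subseteq> V \<Longrightarrow> single m 1 \<in> I"
  shows "monomial_ideal V M \<subseteq> I"
proof
  interpret I: ideal I "poly_ring V" by (rule I)
  have sum_closed: "sum f B \<in> I" if "finite B" "\<And>b. b \<in> B \<Longrightarrow> f b \<in> I"
    for f :: "('v \<Rightarrow>\<^sub>0 nat) \<Rightarrow> ('v, 'k) mpoly" and B
    using that
  proof (induction B)
    case empty
    then show ?case using additive_subgroup.zero_closed[OF I.additive_subgroup_axioms] by (simp add: poly_ring_def)
  next
    case (insert b B)
    then show ?case 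
      using additive_subgroup.a_closed[OF I.additive_subgroup_axioms, of "f b" "sum f B"] by (simp add: poly_ring_def)
  qed
  fix p :: "('v, 'k) mpoly" assume p: "p \<in> monomial_ideal V M"
  have "single m (lookup p m) \<in> I" if "m \<in> keys p" for m
  proof -
    have "keys m \<subseteq> V" using p that by (auto simp: monomial_ideal_def polys_def)
    moreover have "m \<in> M" using p that by (auto simp: monomial_ideal_def)
    moreover have "single 0 (lookup p m) \<in> carrier (poly_ring V)"
      by (simp add: poly_ring_def polys_single)
    ultimately have "single m 1 * single 0 (lookup p m) \<in> I"
      using I.I_r_closed[OF mono] by (simp add: poly_ring_def)
    then show ?thesis by (simp add: mult_single)
  qed
  then have "(\<Sum>m\<in>keys p. single m (lookup p m)) \<in> I" by (intro sum_closed) auto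
  then show "p \<in> I" by (simp only: sum_single_keys)
qed

text \<open>Induction on \<open>n\<close>. Degrees in the variables of \<open>e\<close> add up under
  products, which bounds the power from above. Conversely, a monomial of positive degree in these
  variables is divisible by one of them, which is split off as a factor from the ideal
  itself.\<close>

lemma genideal_var_power:
  fixes V :: "'v set"
  assumes e: "finite e" "e \<subseteq> V"
  shows "(Idl\<^bsub>poly_ring V\<^esub> (var ` e :: ('v, 'k::field) mpoly set)) [^]\<^bsub>ideals_set (poly_ring V)\<^esub> n
    = monomial_ideal V {m. n \<le> (\<Sum>x\<in>e. lookup m x)}"
proof -
  let ?R = "poly_ring V :: ('v, 'k) mpoly ring"
  let ?M = "\<lambda>n. {m. n \<le> (\<Sum>x\<in>e. lookup m x)}"
  interpret cring ?R by (rule cring_poly_ring)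
  define I where "I = Idl\<^bsub>?R\<^esub> (var ` e)"
  have idM: "ideal (monomial_ideal V (?M n) :: ('v, 'k) mpoly set) ?R" for n
    by (rule ideal_monomial_ideal) (auto simp: lookup_add sum.distrib)
  have var_carrier: "var ` e \<subseteq> carrier ?R"
    using e by (auto simp: poly_ring_def var_def polys_def)
  then have I: "ideal I ?R" and var_I: "var ` e \<subseteq> I"
    unfolding I_def by (auto intro: genideal_ideal dest: genideal_self)
  have I_sub: "I \<subseteq> monomial_ideal V (?M 1)"
    unfolding I_def
  proof (rule genideal_minimal[OF idM], safe)
    fix x assume "x \<in> e"
    then have "lookup (single x (1::nat)) x \<le> (\<Sum>y\<in>e. lookup (single x (1::nat)) y)"
      using e by (intro member_le_sum) auto
    then show "var x \<in> monomial_ideal V (?M 1)"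
      using e \<open>x \<in> e\<close> by (auto simp: monomial_ideal_def var_def polys_def)
  qed
  show ?thesis unfolding I_def[symmetric]
  proof (induction n)
    case 0
    show ?case by (simp add: nat_pow_def ideals_set_def monomial_ideal_def poly_ring_def)
  next
    case (Suc n)
    let ?J = "monomial_ideal V (?M n) :: ('v, 'k) mpoly set"
    have "I [^]\<^bsub>ideals_set ?R\<^esub> Suc n = ideal_prod ?R (I [^]\<^bsub>ideals_set ?R\<^esub> n) I"
      by (simp add: nat_pow_def ideals_set_def)
    also have "\<dots> = ideal_prod ?R ?J I" by (simp only: Suc)
    also have "\<dots> = monomial_ideal V (?M (Suc n))"
    proof
      show "ideal_prod ?R ?J I \<subseteq> monomial_ideal V (?M (Suc n))"
      proof
        fix p assume "p \<in> ideal_prod ?R ?J I"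
        then show "p \<in> monomial_ideal V (?M (Suc n))"
        proof induction
          case (prod i j)
          then have ij: "i \<in> ?J" "j \<in> monomial_ideal V (?M 1)" using I_sub by auto
          have "m \<in> ?M (Suc n)" if m: "m \<in> keys (i * j)" for m
          proof -
            obtain a b where "a \<in> keys i" "b \<in> keys j" "m = a + b"
              using keys_mult[of i j] m by blast
            then show ?thesis
              using ij by (fastforce simp: monomial_ideal_def lookup_add sum.distrib)
          qed
          then show ?case
            using ij by (auto simp: monomial_ideal_def poly_ring_def polys_mult)
        next
          case (sum s1 s2)
          then show ?case
            using additive_subgroup.a_closed[OF ideal.axioms(1)[OF idM]] by blast
        qed
      qed
      show "monomial_ideal V (?M (Suc n)) \<subseteq> ideal_prod ?R ?J I"
      proof (rule monomial_ideal_subset[OF ideal_prod_is_ideal[OF idM I]])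
        fix m :: "'v \<Rightarrow>\<^sub>0 nat" assume m: "m \<in> ?M (Suc n)" "keys m \<subseteq> V"
        then obtain x where x: "x \<in> e" "lookup m x > 0"
          by (metis (mono_tags, lifting) le_zero_eq mem_Collect_eq nat.simps(3) not_gr_zero sum.neutral)
        define m' where "m' = m - single x 1"
        have m_eq: "m = m' + single x 1"
          using x by (intro poly_mapping_eqI) (auto simp: m'_def lookup_add lookup_minus lookup_single when_def)
        have "keys m' \<subseteq> V"
          using m(2) by (auto simp: m_eq in_keys_iff subset_iff lookup_add)
        moreover have "(\<Sum>y\<in>e. lookup m y) = (\<Sum>y\<in>e. lookup m' y) + 1"
          using x e by (simp add: m_eq lookup_add sum.distrib lookup_single when_def)
        ultimately have "single m' 1 \<in> ?J"
          using m(1) by (auto simp: monomial_ideal_def polys_single)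
        moreover have "var x \<in> I" using var_I x by auto
        ultimately have "single m' 1 \<otimes>\<^bsub>?R\<^esub> var x \<in> ideal_prod ?R ?J I"
          by (rule ideal_prod.prod)
        then show "single m 1 \<in> ideal_prod ?R ?J I"
          by (simp add: poly_ring_def var_def mult_single m_eq)
      qed
    qed
    finally show ?case .
  qed
qed

text \<open>Intersecting monomial ideals intersects their exponent sets. From here on the graph
  enters only through one inequality per edge.\<close>

lemma cover_ideal_symbolic_power_eq:
  assumes "simple_graph H"
  shows "cover_ideal_symbolic_power H k
    = monomial_ideal (verts H) {m. \<forall>e\<in>edges H. k \<le> (\<Sum>x\<in>e. lookup m x)}"
proof -
  have "finite e \<and> e \<subseteq> verts H" if "e \<in> edges H" for e
    using assms that by (auto simp: simple_graph_def intro: finite_subset)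
  then show ?thesis
    by (auto simp: cover_ideal_symbolic_power_def Let_def genideal_var_power)
      (auto simp: monomial_ideal_def poly_ring_def)
qed

section \<open>Linear syzygies\<close>

lemma mult_mat_vec_nth:
  assumes "i < dim_row A" "dim_col A = dim_vec u"
  shows "(A *\<^sub>v u) $ i = (\<Sum>j<dim_vec u. A $$ (i, j) * u $ j)"
  using assms by (simp add: scalar_prod_def lessThan_atLeast0)

text \<open>Only the generators \<open>D 0\<close> and the first syzygies \<open>D 1\<close> of the
  component of degree \<open>mdeg u\<close> enter. Writing both monomials in the generators and
  passing to their least common multiple gives a syzygy, which by exactness is a combination of
  linear ones. If no exchange existed, a suitable coefficient of it would be both 1 and 0.\<close>

lemma linear_exchange:
  fixes V :: "'v set" and M :: "('v \<Rightarrow>\<^sub>0 nat) set"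
  assumes lin: "componentwise_linear V (monomial_ideal V M :: ('v, 'k::field) mpoly set)"
    and M: "\<And>m n. m \<in> M \<Longrightarrow> m + n \<in> M"
    and u: "u \<in> M" "keys u \<subseteq> V" and v: "v \<in> M" "keys v \<subseteq> V"
    and deg: "mdeg u = mdeg v" and "u \<noteq> v"
  obtains m x y where "m \<in> M" "m + single x 1 = u + single y 1" "x \<noteq> y" "lookup u y < lookup v y"
proof (rule ccontr)
  assume "\<not> thesis"
  with that have no: "m + single x 1 \<noteq> u + single y 1"
    if "m \<in> M" "x \<noteq> y" "lookup u y < lookup v y" for m x y
    using that by blast
  let ?R = "poly_ring V :: ('v, 'k) mpoly ring"
  define d where "d = mdeg u"
  let ?J = "monomial_ideal V M :: ('v, 'k) mpoly set"
  let ?F = "{f \<in> ?J. homogeneous d f}"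
  interpret cring ?R by (rule cring_poly_ring)
  obtain d' r s D where res: "minimal_graded_free_resolution V (Idl\<^bsub>?R\<^esub> ?F) r s D"
    and s: "\<And>i j. j < r i \<Longrightarrow> s i j = d' + i"
    using lin unfolding componentwise_linear_def has_linear_resolution_def by metis
  define f where "f j = D 0 $$ (0, j)" for j
  define t where "t j i = D 1 $$ (j, i)" for j i
  have D0: "D 0 \<in> carrier_mat 1 (r 0)" and D1: "D 1 \<in> carrier_mat (r 0) (r 1)"
    and polys_D: "\<And>i. elements_mat (D i) \<subseteq> polys V"
    and hom0: "\<And>j. j < r 0 \<Longrightarrow> homogeneous (s 0 j) (f j)"
    and hom1: "\<And>i j m. j < r 0 \<Longrightarrow> i < r 1 \<Longrightarrow> m \<in> keys (t j i) \<Longrightarrow> mdeg m + s 0 j = s 1 i"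
    and img: "(\<lambda>u. (D 0 *\<^sub>v u) $ 0) ` free_mod V (r 0) = Idl\<^bsub>?R\<^esub> ?F"
    and ker: "{u \<in> free_mod V (r 0). D 0 *\<^sub>v u = 0\<^sub>v 1} = (\<lambda>w. D 1 *\<^sub>v w) ` free_mod V (r 1)"
    using res unfolding minimal_graded_free_resolution_def f_def t_def by (auto simp: One_nat_def)
  have D0_mult: "(D 0 *\<^sub>v w) $ 0 = (\<Sum>j<r 0. f j * w $ j)" if "dim_vec w = r 0" for w
    using D0 that by (subst mult_mat_vec_nth) (auto simp: f_def)
  have D1_mult: "(D 1 *\<^sub>v w) $ j = (\<Sum>i<r 1. t j i * w $ i)" if "dim_vec w = r 1" "j < r 0" for w j
    using D1 that by (subst mult_mat_vec_nth) (auto simp: t_def)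
  have F_sub: "?F \<subseteq> carrier ?R"
    by (auto simp: poly_ring_def monomial_ideal_def)
  have gen: "single m 1 \<in> Idl\<^bsub>?R\<^esub> ?F" if "m \<in> M" "keys m \<subseteq> V" "mdeg m = d" for m
    using genideal_self[OF F_sub] that
    by (auto simp: monomial_ideal_def homogeneous_def polys_single)
  \<comment> \<open>Keeping the degree bound in the exponent set allows the generating degree to be
    determined below.\<close>
  have ideal_sub: "Idl\<^bsub>?R\<^esub> ?F \<subseteq> monomial_ideal V {m \<in> M. d \<le> mdeg m}"
    by (rule genideal_minimal, rule ideal_monomial_ideal)
      (use M in \<open>auto simp: mdeg_add monomial_ideal_def homogeneous_def\<close>)
  have comb: "\<exists>w\<in>free_mod V (r 0). single m 1 = (\<Sum>j<r 0. f j * w $ j)"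
    if "m \<in> M" "keys m \<subseteq> V" "mdeg m = d" for m
  proof -
    have "single m 1 \<in> (\<lambda>u. (D 0 *\<^sub>v u) $ 0) ` free_mod V (r 0)"
      unfolding img using that by (rule gen)
    then obtain w where w: "w \<in> free_mod V (r 0)" "single m 1 = (D 0 *\<^sub>v w) $ 0"
      by (rule imageE)
    moreover have "dim_vec w = r 0"
      using w(1) by (auto simp: free_mod_def)
    ultimately show ?thesis
      using D0_mult by metis
  qed
  obtain w where w: "w \<in> free_mod V (r 0)" "single u 1 = (\<Sum>j<r 0. f j * w $ j)"
    using comb[OF u] d_def by blast
  obtain w' where w': "w' \<in> free_mod V (r 0)" "single v 1 = (\<Sum>j<r 0. f j * w' $ j)"
    using comb[OF v] deg d_def by auto
  have f_M: "f j \<in> monomial_ideal V {m \<in> M. d \<le> mdeg m}" if "j < r 0" for j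
  proof -
    let ?e = "unit_vec (r 0) j :: ('v, 'k) mpoly vec"
    have e: "?e \<in> free_mod V (r 0)"
      by (auto simp: free_mod_def unit_vec_def polys_zero polys_one)
    have "(D 0 *\<^sub>v ?e) $ 0 = (\<Sum>i<r 0. if i = j then f i else 0)"
      using that by (subst D0_mult, simp, intro sum.cong refl) auto
    then have "f j = (D 0 *\<^sub>v ?e) $ 0" using that by simp
    then have "f j \<in> Idl\<^bsub>?R\<^esub> ?F" unfolding img[symmetric] by (rule image_eqI) (rule e)
    then show ?thesis using ideal_sub by (rule rev_subsetD)
  qed
  \<comment> \<open>A linear resolution may a priori start in any degree \<open>d'\<close>. Some
    generator has a term dividing the monomial \<open>u\<close>, so \<open>d'\<close> is at most
    \<open>d\<close>, while nothing in the ideal has a term of degree below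
    \<open>d\<close>.\<close>
  have "d' = d"
  proof -
    have "(\<Sum>j<r 0. lookup (f j * w $ j) u) = lookup (single u (1::'k)) u"
      unfolding w(2) lookup_sum ..
    then have "(\<Sum>j<r 0. lookup (f j * w $ j) u) \<noteq> 0"
      by simp
    then obtain j where j: "j < r 0" "u \<in> keys (f j * w $ j)"
      unfolding in_keys_iff by (meson lessThan_iff sum.neutral)
    then obtain a b where a: "a \<in> keys (f j)" "u = a + b"
      using keys_mult[of "f j" "w $ j"] by blast
    have "mdeg a = d'" using hom0[OF j(1)] s[OF j(1)] a(1) by (simp add: homogeneous_def)
    moreover have "d \<le> mdeg a" using f_M[OF j(1)] a(1) by (auto simp: monomial_ideal_def)
    moreover have "mdeg a \<le> d" by (simp add: d_def a mdeg_add)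
    ultimately show ?thesis by simp
  qed
  have f_deg: "mdeg m = d \<and> m \<in> M" if "j < r 0" "m \<in> keys (f j)" for j m
    using hom0[OF that(1)] s[OF that(1)] f_M[OF that(1)] that(2) \<open>d' = d\<close>
    by (auto simp: homogeneous_def monomial_ideal_def)
  have t_deg: "mdeg m = 1" if "j < r 0" "i < r 1" "m \<in> keys (t j i)" for j i m
    using hom1[OF that] s that \<open>d' = d\<close> by simp
  have ker_eq: "(\<Sum>j<r 0. f j * t j i) = 0" if "i < r 1" for i
  proof -
    let ?e = "unit_vec (r 1) i :: ('v, 'k) mpoly vec"
    have e: "?e \<in> free_mod V (r 1)"
      by (auto simp: free_mod_def unit_vec_def polys_zero polys_one)
    have col: "(D 1 *\<^sub>v ?e) $ j = t j i" if "j < r 0" for j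
    proof -
      have "(D 1 *\<^sub>v ?e) $ j = (\<Sum>l<r 1. if l = i then t j l else 0)"
        using that \<open>i < r 1\<close> by (subst D1_mult, simp, simp, intro sum.cong refl) auto
      then show ?thesis using \<open>i < r 1\<close> by simp
    qed
    have "D 0 *\<^sub>v (D 1 *\<^sub>v ?e) = 0\<^sub>v 1"
      using ker e by blast
    then have "0 = (D 0 *\<^sub>v (D 1 *\<^sub>v ?e)) $ 0" by simp
    also have "\<dots> = (\<Sum>j<r 0. f j * (D 1 *\<^sub>v ?e) $ j)"
      using D1 by (intro D0_mult) auto
    also have "\<dots> = (\<Sum>j<r 0. f j * t j i)"
      by (intro sum.cong refl) (simp only: col lessThan_iff)
    finally show ?thesis by (rule sym)
  qed
  \<comment> \<open>Subtraction is truncated, so \<open>T\<close> and \<open>T'\<close> are the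
    cofactors of \<open>u\<close> and \<open>v\<close> in their least common multiple.\<close>
  define T where "T = v - u"
  define T' where "T' = u - v"
  have TT': "T + u = T' + v"
    by (rule poly_mapping_eqI) (simp add: T_def T'_def lookup_add lookup_minus)
  have "T \<noteq> T'" using TT' \<open>u \<noteq> v\<close> by auto
  have "mdeg T = mdeg T'" using arg_cong[OF TT', of mdeg] deg by (simp add: mdeg_add)
  have linear_zero: "(\<Sum>j<r 0. lookup (t j i) (single y 1) * lookup (f j) u) = 0"
    if i: "i < r 1" and y: "y \<in> keys T" for i y
  proof -
    have y': "lookup u y < lookup v y" using y by (simp add: T_def in_keys_iff lookup_minus)
    let ?m = "u + single y 1"
    \<comment> \<open>A nonzero coefficient here would put an exponent obtained from
      \<open>u\<close> by trading \<open>x\<close> for \<open>y\<close> into \<open>M\<close>, which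
      \<open>no\<close> forbids. In the coefficient of \<open>?m\<close> in the relation given by
      column \<open>i\<close>, only the summand for \<open>x = y\<close> thus survives.\<close>
    have f0: "lookup (f j) (?m - single x 1) = 0" if "j < r 0" "x \<in> keys ?m" "x \<noteq> y" for j x
    proof -
      have x: "lookup ?m x \<ge> 1" using that by (simp add: in_keys_iff)
      have "?m - single x 1 + single x 1 = ?m"
      proof (rule poly_mapping_eqI)
        fix z show "lookup (?m - single x 1 + single x 1) z = lookup ?m z"
          using x unfolding lookup_add[of "?m - single x 1"] lookup_minus
          by (cases "z = x") (simp_all add: lookup_single)
      qed
      then have "?m - single x 1 \<notin> M" using no[OF _ \<open>x \<noteq> y\<close> y'] by blast
      then show ?thesis using f_deg[OF \<open>j < r 0\<close>] by (auto simp: in_keys_iff)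
    qed
    have y_in: "y \<in> keys ?m" by (simp add: in_keys_iff lookup_add)
    have "0 = lookup (\<Sum>j<r 0. t j i * f j) ?m"
      using ker_eq[OF i] by (simp add: mult.commute)
    also have "\<dots> = (\<Sum>j<r 0. \<Sum>x\<in>keys ?m. lookup (t j i) (single x 1) * lookup (f j) (?m - single x 1))"
      unfolding lookup_sum by (intro sum.cong refl lookup_linear_mult) (use t_deg i in auto)
    also have "\<dots> = (\<Sum>j<r 0. \<Sum>x\<in>{y}. lookup (t j i) (single x 1) * lookup (f j) (?m - single x 1))"
      by (intro sum.cong refl sum.mono_neutral_right) (use f0 y_in in auto)
    finally show ?thesis by simp
  qed
  \<comment> \<open>Under \<open>D 0\<close> both parts are sent to the least common multiple of the
    two monomials, so their difference is a syzygy.\<close>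
  define \<sigma> where "\<sigma> = vec (r 0) (\<lambda>j. single T 1 * w $ j - single T' 1 * w' $ j)"
  have "\<sigma> \<in> {u \<in> free_mod V (r 0). D 0 *\<^sub>v u = 0\<^sub>v 1}"
  proof -
    have keys: "keys T \<subseteq> V" "keys T' \<subseteq> V"
      using u(2) v(2) by (auto simp: T_def T'_def in_keys_iff lookup_minus subset_iff)
    have "\<sigma> $ j \<in> polys V" if "j < r 0" for j
    proof -
      have "single T 1 * w $ j \<in> polys V" "- (single T' 1 * w' $ j) \<in> polys V"
        using that keys w(1) w'(1)
        by (auto simp: free_mod_def intro!: polys_mult polys_single polys_uminus)
      then show ?thesis using that polys_add by (fastforce simp: \<sigma>_def)
    qed
    then have \<sigma>: "\<sigma> \<in> free_mod V (r 0)" by (simp add: free_mod_def \<sigma>_def)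
    have "(D 0 *\<^sub>v \<sigma>) $ 0 = (\<Sum>j<r 0. single T 1 * (f j * w $ j) - single T' 1 * (f j * w' $ j))"
      by (subst D0_mult) (auto simp: \<sigma>_def algebra_simps intro!: sum.cong)
    also have "\<dots> = single T 1 * single u 1 - single T' 1 * single v 1"
      by (simp add: sum_subtractf w(2) w'(2) sum_distrib_left)
    also have "\<dots> = 0" by (simp add: mult_single TT')
    finally have "D 0 *\<^sub>v \<sigma> = 0\<^sub>v 1"
      using D0 by (intro eq_vecI) auto
    with \<sigma> show ?thesis by simp
  qed
  then obtain z where z: "z \<in> free_mod V (r 1)" "\<sigma> = D 1 *\<^sub>v z"
    unfolding ker by blast
  \<comment> \<open>The coefficient of \<open>x\<^sup>T\<close> in the image of \<open>\<sigma>\<close> under the map \<open>e\<^sub>j \<mapsto> [x\<^sup>u] f\<^sub>j\<close>. It is \<open>1\<close> for the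
    Koszul syzygy \<open>\<sigma>\<close>, but without an exchange this map sends every linear syzygy to a linear form in
    the variables not dividing \<open>x\<^sup>T\<close>.\<close>
  define \<psi> where "\<psi> = (\<Sum>j<r 0. lookup (f j) u * lookup (\<sigma> $ j) T)"
  have "\<psi> = 0"
  proof -
    have "lookup (\<sigma> $ j) T = (\<Sum>i<r 1. \<Sum>y\<in>keys T. lookup (t j i) (single y 1) * lookup (z $ i) (T - single y 1))"
      if "j < r 0" for j
    proof -
      have "\<sigma> $ j = (\<Sum>i<r 1. t j i * z $ i)"
        using z that D1_mult by (simp add: free_mod_def)
      then show ?thesis
        unfolding \<open>\<sigma> $ j = _\<close> lookup_sum
        by (intro sum.cong refl lookup_linear_mult) (use t_deg that in auto)
    qed
    then have "\<psi> = (\<Sum>j<r 0. \<Sum>i<r 1. \<Sum>y\<in>keys T.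
        lookup (z $ i) (T - single y 1) * (lookup (t j i) (single y 1) * lookup (f j) u))"
      by (simp add: \<psi>_def sum_distrib_left mult_ac)
    also have "\<dots> = (\<Sum>i<r 1. \<Sum>y\<in>keys T. \<Sum>j<r 0.
        lookup (z $ i) (T - single y 1) * (lookup (t j i) (single y 1) * lookup (f j) u))"
      by (subst sum.swap, intro sum.cong refl, subst sum.swap, rule refl)
    also have "\<dots> = (\<Sum>i<r 1. \<Sum>y\<in>keys T.
        lookup (z $ i) (T - single y 1) * (\<Sum>j<r 0. lookup (t j i) (single y 1) * lookup (f j) u))"
      by (simp only: sum_distrib_left)
    also have "\<dots> = 0"
      by (intro sum.neutral ballI) (use linear_zero in auto)
    finally show ?thesis .
  qed
  moreover have "\<psi> = 1"
  proof -
    \<comment> \<open>Distinct exponents of equal degree do not divide one another, so the part of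
      \<open>\<sigma>\<close> coming from \<open>w'\<close> has no term \<open>T\<close>.\<close>
    have T'_T: "T' + b \<noteq> T" for b
    proof
      assume T: "T' + b = T"
      then have "mdeg b = 0" using \<open>mdeg T = mdeg T'\<close> mdeg_add[of T' b] by simp
      then show False using T \<open>T \<noteq> T'\<close> by (simp add: mdeg_eq_0_iff)
    qed
    have "lookup (\<sigma> $ j) T = lookup (w $ j) 0" if "j < r 0" for j
      using that lookup_monomial_mult[of T "w $ j" 0] lookup_monomial_mult_eq_0[OF T'_T]
      by (simp add: \<sigma>_def lookup_minus)
    then have "\<psi> = (\<Sum>j<r 0. lookup (f j) u * lookup (w $ j) 0)" by (simp add: \<psi>_def)
    also have "\<dots> = (\<Sum>j<r 0. lookup (f j * w $ j) u)"
      by (intro sum.cong refl lookup_mult_top[symmetric]) (use f_deg d_def in auto)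
    also have "\<dots> = lookup (single u 1) u" by (simp only: w(2) lookup_sum)
    finally show ?thesis by simp
  qed
  ultimately show False by simp
qed

text \<open>The exchange property restated for weight functions on the vertices. Vanishing outside
  the finite set \<open>verts H\<close> is what makes these functions exponents.\<close>

lemma componentwise_linear_cover_exchange:
  fixes H :: "'v sgraph"
  assumes H: "simple_graph H"
    and lin: "componentwise_linear (verts H) (cover_ideal_symbolic_power H k :: ('v, 'k::field) mpoly set)"
    and supp: "\<And>x. x \<notin> verts H \<Longrightarrow> u x = 0 \<and> v x = 0"
    and u: "\<And>e. e \<in> edges H \<Longrightarrow> k \<le> (\<Sum>x\<in>e. u x)" and v: "\<And>e. e \<in> edges H \<Longrightarrow> k \<le> (\<Sum>x\<in>e. v x)"
    and deg: "(\<Sum>x\<in>verts H. u x) = (\<Sum>x\<in>verts H. v x)" and neq: "u \<noteq> v"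
  obtains x y where "x \<noteq> y" "u x > 0" "u y < v y"
    "\<And>e. e \<in> edges H \<Longrightarrow> k \<le> (\<Sum>z\<in>e. (u(x := u x - 1, y := u y + 1)) z)"
proof -
  let ?M = "{m. \<forall>e\<in>edges H. k \<le> (\<Sum>x\<in>e. lookup m x)}"
  have fin: "finite (verts H)" using H by (simp add: simple_graph_def)
  have "x \<in> verts H" if "u x \<noteq> 0 \<or> v x \<noteq> 0" for x
    using supp[of x] that by blast
  then have sub: "{x. u x \<noteq> 0} \<subseteq> verts H" "{x. v x \<noteq> 0} \<subseteq> verts H" by auto
  then have fin0: "finite {x. u x \<noteq> 0}" "finite {x. v x \<noteq> 0}"
    using fin finite_subset by blast+
  define m n where "m = Abs_poly_mapping u" and "n = Abs_poly_mapping v"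
  have lk: "lookup m = u" "lookup n = v" using fin0 by (simp_all add: m_def n_def)
  have keys: "keys m \<subseteq> verts H" "keys n \<subseteq> verts H" using sub by (auto simp: in_keys_iff lk)
  have "mdeg m = mdeg n" using mdeg_eq_sum[OF fin keys(1)] mdeg_eq_sum[OF fin keys(2)] deg by (simp add: lk)
  moreover have "m \<noteq> n" using neq lk by auto
  moreover have "a + b \<in> ?M" if "a \<in> ?M" for a b
    using that by (auto simp: lookup_add sum.distrib intro: trans_le_add1)
  moreover have "m \<in> ?M" "n \<in> ?M" using u v by (auto simp: lk)
  ultimately obtain p x y where p: "p \<in> ?M" "p + single x 1 = m + single y 1" "x \<noteq> y" "lookup m y < lookup n y"
    using linear_exchange[OF lin[unfolded cover_ideal_symbolic_power_eq[OF H]], of m n] keys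
    by (smt (verit, best))
  have pl: "lookup p z + lookup (single x 1) z = u z + lookup (single y 1) z" for z
    using arg_cong[OF p(2), of "\<lambda>q. lookup q z"] by (simp add: lookup_add lk)
  have "u x > 0" using pl[of x] p(3) by (simp add: lookup_single)
  moreover have "lookup p = u(x := u x - 1, y := u y + 1)"
  proof
    fix z show "lookup p z = (u(x := u x - 1, y := u y + 1)) z"
      using pl[of z] p(3) by (simp add: lookup_single when_def split: if_splits)
  qed
  ultimately show ?thesis
    using that[of x y] p(1,3,4) by (simp add: lk)
qed

section \<open>Vertex decomposable graphs\<close>

lemma indep_set_del_verts: "indep_set (del_verts G U) A \<longleftrightarrow> indep_set G A \<and> A \<inter> U = {}"
  unfolding indep_set_def del_verts_def by auto

lemma edges_del_verts:
  "simple_graph G \<Longrightarrow> edges (del_verts G U) = {e \<in> edges G. e \<inter> U = {}}"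
  unfolding simple_graph_def del_verts_def by auto

lemma simple_graph_edgeE:
  assumes "simple_graph G" "e \<in> edges G"
  obtains x y where "e = {x, y}" "x \<noteq> y" "x \<in> verts G" "y \<in> verts G"
proof -
  have "card e = 2" "e \<subseteq> verts G" using assms by (auto simp: simple_graph_def)
  then show ?thesis using that by (auto simp: card_2_iff)
qed

lemma simple_graph_edgeD:
  assumes "simple_graph G" "{x, y} \<in> edges G"
  shows "x \<noteq> y" "x \<in> verts G" "y \<in> verts G"
proof -
  have "card {x, y} = 2" "{x, y} \<subseteq> verts G" using assms by (auto simp: simple_graph_def)
  then show "x \<noteq> y" "x \<in> verts G" "y \<in> verts G" by (cases "x = y"; simp)+
qed

lemma indep_set_edgeD: "indep_set G A \<Longrightarrow> {x, y} \<in> edges G \<Longrightarrow> x \<in> A \<Longrightarrow> y \<notin> A"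
  by (auto simp: indep_set_def)

lemma indep_set_mono: "indep_set G A \<Longrightarrow> B \<subseteq> A \<Longrightarrow> indep_set G B"
  unfolding indep_set_def by blast

lemma mem_closed_nbhd:
  assumes "simple_graph G"
  shows "v \<in> closed_nbhd G A \<longleftrightarrow> v \<in> A \<or> (\<exists>a\<in>A. {a, v} \<in> edges G)"
  using simple_graph_edgeD(3)[OF assms] by (auto simp: closed_nbhd_def nbhd_def)

lemma indep_set_Un:
  assumes G: "simple_graph G" and A: "indep_set G A" and B: "indep_set G B"
    and AB: "B \<inter> closed_nbhd G A = {}"
  shows "indep_set G (A \<union> B)"
  unfolding indep_set_def
proof (intro conjI ballI notI)
  show "A \<union> B \<subseteq> verts G" using A B by (auto simp: indep_set_def)
next
  fix e assume e: "e \<in> edges G" "e \<subseteq> A \<union> B"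
  obtain x y where xy: "e = {x, y}" by (rule simple_graph_edgeE[OF G e(1)])
  have *: "{x, y} \<in> edges G" "{y, x} \<in> edges G" using e(1) xy by (simp_all add: insert_commute)
  have AB': "p \<notin> A \<union> B" if "q \<in> A" "{q, p} \<in> edges G" for p q
  proof -
    have "p \<in> closed_nbhd G A" using that by (auto simp: mem_closed_nbhd[OF G])
    then show ?thesis using indep_set_edgeD[OF A that(2,1)] AB by blast
  qed
  have "x \<notin> A" "y \<notin> A" using AB'[OF _ *(1)] AB'[OF _ *(2)] e(2) xy by blast+
  then have "x \<in> B" "y \<in> B" using e(2) xy by auto
  then show False using indep_set_edgeD[OF B *(1)] by blast
qed

lemma closed_nbhd_Un:
  assumes G: "simple_graph G" and B: "B \<inter> closed_nbhd G A = {}" and "B \<subseteq> verts G"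
  shows "closed_nbhd G A \<union> closed_nbhd (del_verts G (closed_nbhd G A)) B = closed_nbhd G (A \<union> B)"
proof -
  let ?D = "del_verts G (closed_nbhd G A)"
  have D: "simple_graph ?D" using G by (rule simple_graph_del_verts)
  have "{b, v} \<in> edges ?D \<longleftrightarrow> {b, v} \<in> edges G \<and> v \<notin> closed_nbhd G A" if "b \<in> B" for b v
    using that B by (auto simp: edges_del_verts[OF G])
  then show ?thesis
    by (auto simp: mem_closed_nbhd[OF G] mem_closed_nbhd[OF D])
qed

lemma closed_nbhd_del_verts:
  assumes G: "simple_graph G" and A: "A \<inter> U = {}"
  shows "U \<union> closed_nbhd (del_verts G U) A = U \<union> closed_nbhd G A"
proof -
  have D: "simple_graph (del_verts G U)" using G by (rule simple_graph_del_verts)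
  have "{b, v} \<in> edges (del_verts G U) \<longleftrightarrow> {b, v} \<in> edges G \<and> v \<notin> U" if "b \<in> A" for b v
    using that A by (auto simp: edges_del_verts[OF G])
  then show ?thesis
    by (auto simp: mem_closed_nbhd[OF G] mem_closed_nbhd[OF D])
qed

text \<open>A maximal independent set \<open>I\<close> of the link that violates shedding gives the
  independent set \<open>A \<union> I\<close> of \<open>G\<close>, which avoids the closed
  neighbourhood of \<open>x\<close>. Shedding in \<open>G\<close> extends it to a larger
  \<open>B\<close> without \<open>x\<close>, and \<open>B - A\<close> then properly extends
  \<open>I\<close> inside the link.\<close>

lemma shedding_vertex_link:
  assumes G: "simple_graph G" and x: "shedding_vertex G x" and A: "indep_set G A"
    and xA: "x \<notin> closed_nbhd G A"
  shows "shedding_vertex (del_verts G (closed_nbhd G A)) x"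
  unfolding shedding_vertex_def
proof (intro conjI allI impI notI)
  let ?L = "del_verts G (closed_nbhd G A)"
  show "x \<in> verts ?L" using x xA by (simp add: shedding_vertex_def del_verts_def)
  fix I assume "indep_set (del_verts ?L (closed_nbhd ?L {x})) I" and max: "max_indep_set (del_verts ?L {x}) I"
  then have I: "indep_set G I" "I \<inter> closed_nbhd G A = {}" "I \<inter> closed_nbhd ?L {x} = {}"
    by (auto simp: indep_set_del_verts)
  have "x \<in> verts G" using x by (simp add: shedding_vertex_def)
  have Ix: "I \<inter> closed_nbhd G {x} = {}"
    using I(2,3) xA
    by (auto simp: disjoint_iff insert_commute mem_closed_nbhd[OF G]
        mem_closed_nbhd[OF simple_graph_del_verts[OF G]] edges_del_verts[OF G])
  moreover have Ax: "A \<inter> closed_nbhd G {x} = {}"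
    using xA by (auto simp: mem_closed_nbhd[OF G] insert_commute)
  ultimately have "\<not> max_indep_set (del_verts G {x}) (A \<union> I)"
    using x indep_set_Un[OF G A I(1,2)]
    by (auto simp: shedding_vertex_def indep_set_del_verts)
  moreover have "indep_set (del_verts G {x}) (A \<union> I)"
    using indep_set_Un[OF G A I(1,2)] Ix Ax
    by (auto simp: indep_set_del_verts mem_closed_nbhd[OF G])
  ultimately obtain B where B: "indep_set (del_verts G {x}) B" "A \<union> I \<subseteq> B" "B \<noteq> A \<union> I"
    by (auto simp: max_indep_set_def)
  have "v \<notin> B" if "a \<in> A" "{a, v} \<in> edges G" for a v
    using indep_set_edgeD[of G B a v] B(1,2) that by (auto simp: indep_set_del_verts)
  then have "(B - A) \<inter> closed_nbhd G A = {}"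
    by (auto simp: mem_closed_nbhd[OF G])
  then have "indep_set (del_verts ?L {x}) (B - A)"
    using B(1) indep_set_mono[of G B "B - A"] by (auto simp: indep_set_del_verts)
  moreover have "I \<subseteq> B - A" using B(2) I(2) by (auto simp: mem_closed_nbhd[OF G])
  ultimately have "B - A = I" using max by (auto simp: max_indep_set_def)
  then show False using B by auto
qed

text \<open>Induction along the decomposition, by the position of the shedding vertex
  \<open>x\<close>. If \<open>x\<close> is in \<open>A\<close>, the link is a link of the link of
  \<open>x\<close>; if \<open>x\<close> is a neighbour of \<open>A\<close>, it is a link of the
  deletion of \<open>x\<close>; otherwise \<open>x\<close> is still shedding, and deletion and link
  at \<open>x\<close> commute with the link at \<open>A\<close>.\<close>

lemma vertex_decomposable_link:
  assumes "vertex_decomposable G" "simple_graph G" "indep_set G A"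
  shows "vertex_decomposable (del_verts G (closed_nbhd G A))"
  using assms
proof (induction arbitrary: A rule: vertex_decomposable.induct)
  case (no_edges G)
  then show ?case by (intro vertex_decomposable.no_edges) (auto simp: del_verts_def)
next
  case (shed G x)
  note G = \<open>simple_graph G\<close> and A = \<open>indep_set G A\<close>
  have xG: "x \<in> verts G" using shed(1) by (simp add: shedding_vertex_def)
  have AG: "A \<subseteq> verts G" using A by (simp add: indep_set_def)
  consider "x \<in> A" | "x \<notin> A" "x \<in> closed_nbhd G A" | "x \<notin> A" "x \<notin> closed_nbhd G A" by blast
  then show ?case
  proof cases
    case 1
    have disj: "(A - {x}) \<inter> closed_nbhd G {x} = {}"
      using indep_set_edgeD[OF A _ 1] by (auto simp: mem_closed_nbhd[OF G])
    have sub: "A - {x} \<subseteq> verts G" using AG by blast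
    have "indep_set (del_verts G (closed_nbhd G {x})) (A - {x})"
      using indep_set_mono[OF A, of "A - {x}"] disj by (simp add: indep_set_del_verts)
    from shed(5)[OF simple_graph_del_verts[OF G] this] show ?thesis
      using closed_nbhd_Un[OF G disj] 1 by (simp add: del_verts_del_verts insert_absorb sub)
  next
    case 2
    have "indep_set (del_verts G {x}) A" using A 2 by (simp add: indep_set_del_verts)
    from shed(4)[OF simple_graph_del_verts[OF G] this] show ?thesis
      using closed_nbhd_del_verts[OF G, of A "{x}"] 2 by (simp add: del_verts_del_verts insert_absorb)
  next
    case 3
    let ?L = "del_verts G (closed_nbhd G A)"
    have "indep_set (del_verts G {x}) A" using A 3 by (simp add: indep_set_del_verts)
    from shed(4)[OF simple_graph_del_verts[OF G] this] have "vertex_decomposable (del_verts ?L {x})"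
      using closed_nbhd_del_verts[OF G, of A "{x}"] 3 by (simp add: del_verts_del_verts)
    moreover have "vertex_decomposable (del_verts ?L (closed_nbhd ?L {x}))"
    proof -
      have disj: "A \<inter> closed_nbhd G {x} = {}" 
        using 3 by (auto simp: mem_closed_nbhd[OF G] insert_commute)
      then have "indep_set (del_verts G (closed_nbhd G {x})) A"
        using A by (simp add: indep_set_del_verts)
      from shed(5)[OF simple_graph_del_verts[OF G] this] show ?thesis
        using closed_nbhd_Un[OF G disj] closed_nbhd_Un[OF G, of "{x}" A] AG xG 3
        by (simp add: del_verts_del_verts)
    qed
    ultimately show ?thesis
      by (rule vertex_decomposable.shed[OF shedding_vertex_link[OF G shed(1) A 3(2)]])
  qed
qed

section \<open>Injective renaming of vertices\<close>

definition map_graph :: "('v \<Rightarrow> 'w) \<Rightarrow> 'v sgraph \<Rightarrow> 'w sgraph" where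
  "map_graph f G = \<lparr> verts = f ` verts G, edges = (`) f ` edges G \<rparr>"

context
  fixes f :: "'v \<Rightarrow> 'w"
  assumes f: "inj f"
begin

lemma del_verts_map_graph: "del_verts (map_graph f G) (f ` U) = map_graph f (del_verts G U)"
  using f by (auto simp: del_verts_def map_graph_def inj_image_subset_iff image_set_diff[symmetric])

lemma edge_map_graph_iff: "f ` e \<in> edges (map_graph f G) \<longleftrightarrow> e \<in> edges G"
  using f by (auto simp: map_graph_def inj_image_eq_iff)

lemma closed_nbhd_map_graph: "closed_nbhd (map_graph f G) (f ` A) = f ` closed_nbhd G A"
proof -
  have "{f a, f v} \<in> edges (map_graph f G) \<longleftrightarrow> {a, v} \<in> edges G" for a v
    using edge_map_graph_iff[of "{a, v}" G] by simp
  moreover have "verts (map_graph f G) = f ` verts G" by (simp add: map_graph_def)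
  ultimately show ?thesis
    by (auto simp: closed_nbhd_def nbhd_def)
qed

lemma indep_set_map_graph: "indep_set (map_graph f G) (f ` A) \<longleftrightarrow> indep_set G A"
  using f by (auto simp: indep_set_def map_graph_def inj_image_subset_iff)

lemma max_indep_set_map_graph: "max_indep_set (map_graph f G) (f ` A) \<longleftrightarrow> max_indep_set G A"
proof -
  \<comment> \<open>Independent sets of the renamed graph consist of its vertices and so are images;
    the quantifier in maximality can be pulled back.\<close>
  have "\<exists>B'. B = f ` B'" if "indep_set (map_graph f G) B" for B
    using that by (auto simp: indep_set_def map_graph_def subset_image_iff)
  then have "(\<forall>B. indep_set (map_graph f G) B \<longrightarrow> P B) \<longleftrightarrow> (\<forall>B. indep_set G B \<longrightarrow> P (f ` B))" for P
    using indep_set_map_graph by metis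
  then show ?thesis
    using f by (simp add: max_indep_set_def indep_set_map_graph inj_image_subset_iff inj_image_eq_iff)
qed

lemma shedding_vertex_map_graph: "shedding_vertex (map_graph f G) (f x) \<Longrightarrow> shedding_vertex G x"
  unfolding shedding_vertex_def
  using f indep_set_map_graph max_indep_set_map_graph del_verts_map_graph[of G "{x}"]
    closed_nbhd_map_graph[of G "{x}"] del_verts_map_graph[of G "closed_nbhd G {x}"]
  by (auto simp: map_graph_def inj_image_mem_iff) metis

text \<open>Meant for \<open>Inl\<close>: whiskered graphs live on a sum type, and a link of one
  will be a renamed copy of a graph on the original vertices.\<close>

lemma vertex_decomposable_map_graphD:
  assumes "vertex_decomposable (map_graph f G)"
  shows "vertex_decomposable G"
  using assms
proof (induction "map_graph f G" arbitrary: G rule: vertex_decomposable.induct)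
  case no_edges
  then show ?case by (intro vertex_decomposable.no_edges) (simp add: map_graph_def)
next
  case (shed y)
  then obtain x where x: "y = f x" by (auto simp: shedding_vertex_def map_graph_def)
  have "vertex_decomposable (del_verts G {x})"
    using shed(3)[of "del_verts G {x}"] del_verts_map_graph[of G "{x}"] x by simp
  moreover have "vertex_decomposable (del_verts G (closed_nbhd G {x}))"
    using shed(5)[of "del_verts G (closed_nbhd G {x})"] del_verts_map_graph[of G "closed_nbhd G {x}"]
      closed_nbhd_map_graph[of G "{x}"] x by simp
  ultimately show ?case
    using shedding_vertex_map_graph[of G x] shed(1) x by (intro vertex_decomposable.shed[of G x]) simp_all
qed

end

section \<open>Leaves and vertex decomposability\<close>

lemma closed_nbhd_empty: "closed_nbhd G {} = {}"
  by (simp add: closed_nbhd_def nbhd_def)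

text \<open>Phrased through edges alone, so that graphs differing only in isolated vertices have the
  same leaf edges.\<close>

definition leaf_edge :: "'v sgraph \<Rightarrow> 'v \<Rightarrow> 'v \<Rightarrow> bool" where
  "leaf_edge G x y \<longleftrightarrow> {x, y} \<in> edges G \<and> (\<forall>e\<in>edges G. x \<in> e \<longrightarrow> e = {x, y})"

lemma leaf_edge_cong: "edges G = edges H \<Longrightarrow> leaf_edge G x y = leaf_edge H x y"
  by (simp only: leaf_edge_def)

text \<open>An independent set avoiding the closed neighbourhood of \<open>y\<close> omits
  \<open>x\<close>. Once \<open>y\<close> is deleted, \<open>x\<close> is isolated and can be added
  to it.\<close>

lemma shedding_vertex_leaf_neighbour:
  assumes G: "simple_graph G" and leaf: "leaf_edge G x y"
  shows "shedding_vertex G y"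
  unfolding shedding_vertex_def
proof (intro conjI allI impI notI)
  have xy: "{x, y} \<in> edges G" and x: "\<And>v. {x, v} \<in> edges G \<Longrightarrow> v = y"
    using leaf by (auto simp: leaf_edge_def doubleton_eq_iff)
  show "y \<in> verts G" using simple_graph_edgeD[OF G xy] by simp
  fix I assume I: "indep_set (del_verts G (closed_nbhd G {y})) I" and max: "max_indep_set (del_verts G {y}) I"
  have "x \<notin> I" "y \<notin> I"
    using I xy by (auto simp: indep_set_del_verts mem_closed_nbhd[OF G] insert_commute)
  have "indep_set G {x}"
    using simple_graph_edgeD(2)[OF G xy] G by (auto simp: indep_set_def simple_graph_def card_2_iff)
  then have "indep_set G ({x} \<union> I)"
    using I \<open>x \<notin> I\<close> \<open>y \<notin> I\<close> x
    by (intro indep_set_Un[OF G]) (auto simp: indep_set_del_verts mem_closed_nbhd[OF G])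
  then have "indep_set (del_verts G {y}) ({x} \<union> I)"
    using \<open>y \<notin> I\<close> simple_graph_edgeD(1)[OF G xy] by (auto simp: indep_set_del_verts)
  then show False using max \<open>x \<notin> I\<close> by (auto simp: max_indep_set_def)
qed

text \<open>Induction on the number of vertices, shedding the neighbour \<open>y\<close> of a leaf
  \<open>x\<close>. The leaf condition is inherited: links of the link of \<open>y\<close> are links
  of \<open>G\<close>, and links of the deletion of \<open>y\<close> have the same edges as links of
  \<open>G\<close> at sets containing \<open>x\<close>.\<close>

lemma vertex_decomposable_if_leaves:
  assumes "simple_graph G"
    and "\<And>C. indep_set G C \<Longrightarrow> edges (del_verts G (closed_nbhd G C)) \<noteq> {} \<Longrightarrow>
      \<exists>x y. leaf_edge (del_verts G (closed_nbhd G C)) x y"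
  shows "vertex_decomposable G"
  using assms
proof (induction "card (verts G)" arbitrary: G rule: less_induct)
  case less
  note G = less.prems(1)
  have fin: "finite (verts G)" using G by (simp add: simple_graph_def)
  show ?case
  proof (cases "edges G = {}")
    case True
    then show ?thesis by (rule vertex_decomposable.no_edges)
  next
    case False
    have "indep_set G {}"
      using G by (auto simp: indep_set_def simple_graph_def)
    with False obtain x y where leaf: "leaf_edge G x y"
      using less.prems(2)[of "{}"] by (auto simp: closed_nbhd_empty del_verts_empty[OF G])
    have xy: "{x, y} \<in> edges G" and x: "\<And>e. e \<in> edges G \<Longrightarrow> x \<in> e \<Longrightarrow> e = {x, y}"
      using leaf unfolding leaf_edge_def by blast+
    note xyD = simple_graph_edgeD[OF G xy]
    have y: "shedding_vertex G y" using G leaf by (rule shedding_vertex_leaf_neighbour)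
    have smaller: "card (verts (del_verts G U)) < card (verts G)" if "y \<in> U" for U
      using that xyD(3) fin by (intro psubset_card_mono) (auto simp: del_verts_def)
    have "vertex_decomposable (del_verts G {y})"
    proof (rule less.hyps[OF smaller simple_graph_del_verts[OF G]])
      let ?D = "del_verts G {y}"
      fix C assume C: "indep_set ?D C" and ne: "edges (del_verts ?D (closed_nbhd ?D C)) \<noteq> {}"
      then have C': "indep_set G C" "y \<notin> C" by (auto simp: indep_set_del_verts)
      have x': "v = y" if "{x, v} \<in> edges G \<or> {v, x} \<in> edges G" for v
        using x[of "{x, v}"] that by (auto simp: doubleton_eq_iff insert_commute)
      have "indep_set G {x}"
        using xyD G by (auto simp: indep_set_def simple_graph_def card_2_iff)
      have Cx: "indep_set G (insert x C)"
      proof (cases "x \<in> C")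
        case False
        have "indep_set G (C \<union> {x})"
          using C' False x' \<open>indep_set G {x}\<close> by (intro indep_set_Un[OF G]) (auto simp: mem_closed_nbhd[OF G])
        then show ?thesis by simp
      qed (use C' in \<open>simp add: insert_absorb\<close>)
      have "edges (del_verts ?D (closed_nbhd ?D C)) = {e \<in> edges G. e \<inter> ({y} \<union> closed_nbhd G C) = {}}"
        using closed_nbhd_del_verts[OF G, of C "{y}"] C'(2)
        by (simp add: del_verts_del_verts edges_del_verts[OF G])
      \<comment> \<open>Adding the leaf \<open>x\<close> to \<open>C\<close> removes exactly
        \<open>x\<close> and \<open>y\<close> in addition, and every edge at \<open>x\<close> is
        already lost with \<open>y\<close>.\<close>
      also have "\<dots> = {e \<in> edges G. e \<inter> closed_nbhd G (insert x C) = {}}"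
      proof -
        have "closed_nbhd G (insert x C) = {x, y} \<union> closed_nbhd G C"
          using x' xy by (auto simp: mem_closed_nbhd[OF G])
        moreover have "x \<notin> e" if "e \<in> edges G" "y \<notin> e" for e
          using x that by blast
        ultimately show ?thesis by auto
      qed
      also have "\<dots> = edges (del_verts G (closed_nbhd G (insert x C)))"
        by (simp add: edges_del_verts[OF G])
      finally show "\<exists>a b. leaf_edge (del_verts ?D (closed_nbhd ?D C)) a b"
        using less.prems(2)[OF Cx] ne leaf_edge_cong by metis
    qed simp
    moreover have "vertex_decomposable (del_verts G (closed_nbhd G {y}))"
    proof (rule less.hyps[OF smaller simple_graph_del_verts[OF G]])
      show "y \<in> closed_nbhd G {y}" by (simp add: closed_nbhd_def)
      let ?D = "del_verts G (closed_nbhd G {y})"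
      fix C assume C: "indep_set ?D C" and ne: "edges (del_verts ?D (closed_nbhd ?D C)) \<noteq> {}"
      then have C': "indep_set G C" "C \<inter> closed_nbhd G {y} = {}" by (auto simp: indep_set_del_verts)
      have "indep_set G {y}"
        using xyD G by (auto simp: indep_set_def simple_graph_def card_2_iff)
      then have Cy: "indep_set G ({y} \<union> C)" using C' by (intro indep_set_Un[OF G])
      have D_eq: "del_verts ?D (closed_nbhd ?D C) = del_verts G (closed_nbhd G ({y} \<union> C))"
        using closed_nbhd_Un[OF G C'(2)] C'(1) by (simp add: del_verts_del_verts indep_set_def)
      show "\<exists>a b. leaf_edge (del_verts ?D (closed_nbhd ?D C)) a b"
        unfolding D_eq using ne unfolding D_eq by (rule less.prems(2)[OF Cy])
    qed
    ultimately show ?thesis by (rule vertex_decomposable.shed[OF y])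
  qed
qed

section \<open>Shedding orders\<close>

lemma shedding_order_subset:
  assumes "shedding_order H as"
  shows "set as \<subseteq> verts H"
proof
  fix a assume "a \<in> set as"
  then obtain i where "i < length as" "a = as ! i" by (auto simp: in_set_conv_nth)
  then show "a \<in> verts H"
    using assms by (auto simp: shedding_order_def shedding_vertex_def del_verts_def)
qed

text \<open>If this fails, let \<open>a\<close> be the last counterexample. A maximal independent set avoiding \<open>N[a]\<close> that
  contains all of \<open>verts H - set as\<close> cannot be extended by any neighbour of \<open>a\<close>, because these
  come later in the order; so \<open>a\<close> is not shedding.\<close>

lemma shedding_order_neighbour:
  assumes H: "simple_graph H" and as: "shedding_order H as" and "a \<in> set as"
  shows "\<exists>b\<in>verts H - set as. {a, b} \<in> edges H"
proof (rule ccontr)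
  assume no: "\<not> ?thesis"
  let ?Q = "verts H - set as"
  let ?bad = "\<lambda>i. i < length as \<and> (\<forall>b\<in>?Q. {as ! i, b} \<notin> edges H)"
  obtain i0 where "?bad i0" using no \<open>a \<in> set as\<close> by (metis in_set_conv_nth)
  then obtain i where i: "?bad i" and last: "\<And>j. ?bad j \<Longrightarrow> j \<le> i"
    using ex_has_greatest_nat[of ?bad i0 "\<lambda>i. i" "length as"] by auto
  let ?K = "del_verts H (set (take i as))"
  let ?D = "del_verts ?K (closed_nbhd ?K {as ! i})"
  let ?a = "as ! i"
  have K: "simple_graph ?K" using H by (rule simple_graph_del_verts)
  have a: "shedding_vertex ?K ?a" using as i by (simp add: shedding_order_def)
  have Q_edges: "e \<notin> edges H" if "e \<subseteq> ?Q" for e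
    using as that by (auto simp: shedding_order_def edges_del_verts[OF H])
  have take: "set (take i as) \<subseteq> set as" by (rule set_take_subset)
  have Q: "indep_set ?D ?Q"
  proof -
    have "?Q \<inter> closed_nbhd ?K {?a} = {}"
      using i by (auto simp: mem_closed_nbhd[OF K] edges_del_verts[OF H])
    moreover have "indep_set H ?Q" using Q_edges by (auto simp: indep_set_def)
    ultimately show ?thesis using take by (auto simp: indep_set_del_verts)
  qed
  let ?P = "\<lambda>I. indep_set ?D I \<and> ?Q \<subseteq> I"
  have "finite (verts ?D)" using H by (simp add: simple_graph_def del_verts_def)
  then have bound: "\<forall>I. ?P I \<longrightarrow> card I < Suc (card (verts ?D))"
    unfolding indep_set_def less_Suc_eq_le by (blast intro: card_mono)
  have "?P ?Q" using Q by blast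
  from Lattices_Big.ex_has_greatest_nat[of ?P, OF this bound]
  obtain I where I: "?P I" and max: "\<And>B. ?P B \<Longrightarrow> card B \<le> card I" by blast
  have "\<not> max_indep_set (del_verts ?K {?a}) I"
    using a I by (auto simp: shedding_vertex_def)
  moreover have "indep_set (del_verts ?K {?a}) I"
    using I by (auto simp: indep_set_del_verts closed_nbhd_def)
  ultimately obtain B where B: "indep_set (del_verts ?K {?a}) B" "I \<subseteq> B" "B \<noteq> I"
    by (auto simp: max_indep_set_def)
  then obtain w where w: "w \<in> B" "w \<notin> I" by blast
  have wI: "indep_set (del_verts ?K {?a}) (insert w I)"
    using B w by (intro indep_set_mono[OF B(1)]) auto
  show False
  proof (cases "w \<in> closed_nbhd ?K {?a}")
    case False
    then have "?P (insert w I)"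
      using wI I by (auto simp: indep_set_del_verts)
    moreover have "finite I" using I H by (auto simp: indep_set_def simple_graph_def del_verts_def intro: finite_subset)
    ultimately show False using max[of "insert w I"] w by simp
  next
    case True
    \<comment> \<open>Being a vertex of \<open>?K\<close> other than \<open>?a\<close>, and in
      \<open>set as\<close>, \<open>w\<close> has an index beyond \<open>i\<close>. By the choice of
      \<open>i\<close> it has a neighbour in \<open>?Q\<close>, all of which lies in
      \<open>I\<close>.\<close>
    have "w \<noteq> ?a" "w \<in> verts H" "w \<notin> set (take i as)" using wI by (auto simp: indep_set_def del_verts_def)
    moreover have "w \<in> set as" using w(2) I \<open>w \<in> verts H\<close> by auto
    ultimately obtain j where j: "j < length as" "w = as ! j" by (auto simp: in_set_conv_nth)
    have "w \<in> set (take i as)" if "j < i"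
      using that j i by (auto simp: in_set_conv_nth intro!: exI[of _ j])
    then have "i < j" using \<open>w \<noteq> ?a\<close> \<open>w \<notin> set (take i as)\<close> j by (metis linorder_neqE_nat)
    then obtain b where b: "b \<in> ?Q" "{w, b} \<in> edges H" using last[of j] j by (auto simp: not_le[symmetric])
    have "indep_set H (insert w I)" using wI by (simp add: indep_set_del_verts)
    from indep_set_edgeD[OF this b(2)] show False using I b(1) by blast
  qed
qed

section \<open>Whiskered graphs\<close>

lemma simple_graph_add_whiskers:
  assumes G: "simple_graph G" and S: "S \<subseteq> verts G"
  shows "simple_graph (add_whiskers G S)"
  unfolding simple_graph_def
proof (intro conjI ballI)
  have "finite (verts G)" using G by (simp add: simple_graph_def)
  moreover from this S have "finite S" by (rule finite_subset[rotated])
  ultimately show "finite (verts (add_whiskers G S))" by (simp add: add_whiskers_def)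
  fix e assume "e \<in> edges (add_whiskers G S)"
  then consider e' where "e' \<in> edges G" "e = Inl ` e'" | x where "x \<in> S" "e = {Inl x, Inr x}"
    by (auto simp: add_whiskers_def)
  then have "e \<subseteq> verts (add_whiskers G S) \<and> card e = 2"
  proof cases
    case 1
    then have "e' \<subseteq> verts G" "card e' = 2" using G by (auto simp: simple_graph_def)
    then show ?thesis
      using 1 by (auto simp: add_whiskers_def card_image)
  next
    case 2
    then show ?thesis
      using S by (auto simp: add_whiskers_def)
  qed
  then show "e \<subseteq> verts (add_whiskers G S)" "card e = 2" by simp_all
qed

lemma cover_add_whiskers_iff:
  assumes G: "simple_graph G"
  shows "(\<forall>e\<in>edges (add_whiskers G S). k \<le> (\<Sum>x\<in>e. f x)) \<longleftrightarrow>
    (\<forall>x y. {x, y} \<in> edges G \<longrightarrow> k \<le> f (Inl x) + f (Inl y)) \<and> (\<forall>x\<in>S. k \<le> f (Inl x) + f (Inr x))"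
proof -
  have "k \<le> (\<Sum>x\<in>Inl ` e. f x)"
    if e: "e \<in> edges G" and le: "\<And>x y. {x, y} \<in> edges G \<Longrightarrow> k \<le> f (Inl x) + f (Inl y)" for e
  proof -
    obtain x y where xy: "e = {x, y}" "x \<noteq> y" by (rule simple_graph_edgeE[OF G e])
    then show ?thesis using le[of x y] e by simp
  qed
  moreover have "k \<le> f (Inl x) + f (Inl y)"
    if "{x, y} \<in> edges G" and le: "\<And>e. e \<in> edges G \<Longrightarrow> k \<le> (\<Sum>x\<in>Inl ` e. f x)" for x y
    using le[OF that(1)] simple_graph_edgeD(1)[OF G that(1)] by simp
  ultimately show ?thesis
    unfolding add_whiskers_def by (simp add: ball_Un) blast
qed

text \<open>Two weight functions cover all edges: a common one raised by 1 on \<open>X\<close>, or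
  on \<open>Y\<close>. An exchange lowers some \<open>a\<close> and raises some \<open>b\<close>.
  Everything else being tight, \<open>a\<close> lies on the raised side, and each edge of
  \<open>L\<close> at \<open>a\<close> stays covered only if its other end is \<open>b\<close>; so
  \<open>a\<close> is a leaf.\<close>

lemma leaf_edge_bip_graph_link:
  fixes G :: "'v sgraph"
  assumes G: "simple_graph G" and S: "S \<subseteq> verts G" and k: "k \<ge> 2"
    and lin: "componentwise_linear (verts (add_whiskers G S))
      (cover_ideal_symbolic_power (add_whiskers G S) k :: ('v + 'v, 'k::field) mpoly set)"
    and A: "indep_set (del_verts G S) A"
  defines "H \<equiv> del_verts (del_verts G S) (closed_nbhd (del_verts G S) A)"
  assumes as: "shedding_order H as"
    and C: "indep_set (bip_graph H as) C"
  defines "L \<equiv> del_verts (bip_graph H as) (closed_nbhd (bip_graph H as) C)"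
  assumes ne: "edges L \<noteq> {}"
  shows "\<exists>x y. leaf_edge L x y"
proof -
  let ?W = "add_whiskers G S" and ?G' = "del_verts G S" and ?B = "bip_graph H as"
  define N where "N = closed_nbhd ?G' A - A"
  define P where "P = set as"
  define Q where "Q = verts H - set as"
  define M where "M = closed_nbhd ?B C"
  \<comment> \<open>The two sides of \<open>L\<close> without its isolated vertices, so that each
    vertex of \<open>X\<close> or \<open>Y\<close> lies on an edge of \<open>L\<close>.\<close>
  define X where "X = Q \<inter> \<Union> (edges L)"
  define Y where "Y = P \<inter> \<Union> (edges L)"
  have G': "simple_graph ?G'" using G by (rule simple_graph_del_verts)
  then have H: "simple_graph H" unfolding H_def by (rule simple_graph_del_verts)
  have B: "simple_graph ?B" using H by (auto simp: simple_graph_def bip_graph_def)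
  have P_H: "P \<subseteq> verts H" using shedding_order_subset[OF as] by (simp add: P_def)
  have PQ: "P \<inter> Q = {}" "verts H = P \<union> Q" using P_H by (auto simp: P_def Q_def)
  have A_G: "A \<subseteq> verts G" "A \<inter> S = {}" using A by (auto simp: indep_set_def del_verts_def)
  have N_G: "N \<subseteq> verts G" "N \<inter> S = {}" "N \<inter> A = {}"
    by (auto simp: N_def closed_nbhd_def nbhd_def del_verts_def)
  have verts_H: "verts H = verts G - S - A - N"
    by (auto simp: H_def N_def del_verts_def closed_nbhd_def)
  have edge_H: "{x, y} \<in> edges H" if "{x, y} \<in> edges G" "x \<in> verts H" "y \<in> verts H" for x y
    using that unfolding H_def by (simp add: del_verts_def)
  have edge_HG: "e \<in> edges G" if "e \<in> edges H" for e
    using that unfolding H_def by (simp add: del_verts_def)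
  have edge_B: "{p, q} \<in> edges ?B" if "{p, q} \<in> edges G" "p \<in> P" "q \<in> Q" for p q
  proof -
    have "{p, q} \<in> edges H" using that PQ(2) by (intro edge_H) simp_all
    moreover have "{p, q} = {q, p}" by (rule insert_commute)
    ultimately show ?thesis
      using that(2,3) unfolding bip_graph_def P_def Q_def by auto
  qed
  have edge_BE: "\<exists>p\<in>P. \<exists>q\<in>Q. e = {p, q} \<and> {p, q} \<in> edges G" if e: "e \<in> edges ?B" for e
  proof -
    obtain q p where "q \<in> Q" "p \<in> P" "e = {q, p}" "e \<in> edges H"
      using e by (auto simp: bip_graph_def P_def Q_def)
    then show ?thesis using edge_HG[of e] insert_commute[of q p "{}"] by auto
  qed
  have edges_L: "edges L = {e \<in> edges ?B. e \<inter> M = {}}"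
    unfolding L_def M_def by (rule edges_del_verts[OF B])
  have XY_M: "X \<inter> M = {}" "Y \<inter> M = {}" using edges_L by (auto simp: X_def Y_def)
  have XQ: "X \<subseteq> Q" "Y \<subseteq> P" by (auto simp: X_def Y_def)
  have XY: "X \<inter> Y = {}" using XQ PQ(1) by blast
  have fin: "finite (verts G)" using G by (simp add: simple_graph_def)
  have mem_M: "v \<in> M \<longleftrightarrow> v \<in> C \<or> (\<exists>c\<in>C. {c, v} \<in> edges ?B)" for v
    unfolding M_def by (rule mem_closed_nbhd[OF B])
  have pq: "p \<in> M - C \<or> q \<in> M - C \<or> p \<in> Y \<and> q \<in> X"
    if "{p, q} \<in> edges G" "p \<in> P" "q \<in> Q" for p q
  proof -
    have e: "{p, q} \<in> edges ?B" "{q, p} \<in> edges ?B" using edge_B[OF that] by (simp_all add: insert_commute)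
    consider "p \<in> C" | "q \<in> C" | "p \<notin> C" "q \<notin> C" by blast
    then show ?thesis
    proof cases
      case 1
      then show ?thesis using indep_set_edgeD[OF C e(1)] mem_M[of q] e by blast
    next
      case 2
      then show ?thesis using indep_set_edgeD[OF C e(2)] mem_M[of p] e by blast
    next
      case 3
      have "p \<in> Y \<and> q \<in> X" if "p \<notin> M" "q \<notin> M"
      proof -
        have "{p, q} \<in> edges L" using e that by (simp add: edges_L)
        then show ?thesis using \<open>p \<in> P\<close> \<open>q \<in> Q\<close> by (auto simp: X_def Y_def)
      qed
      then show ?thesis using 3 by blast
    qed
  qed
  \<comment> \<open>The whisker vertices and \<open>A\<close> get weight 0, which forces
    \<open>k\<close> on \<open>S\<close> and on the neighbours \<open>N\<close> of \<open>A\<close>.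
    After subtracting \<open>k - 1\<close> on \<open>P\<close>, the rest is a 0/1 cover of the
    bipartite graph that leaves out \<open>C\<close> and hence takes its neighbours
    \<open>M - C\<close>; the edges of \<open>L\<close> are still uncovered.\<close>
  define base where "base x = (if x \<in> S \<union> N then k else if x \<in> P then (if x \<in> M - C then k else k - 1)
    else if x \<in> Q \<inter> (M - C) then 1 else 0)" for x
  define g where "g Z x = base x + (if x \<in> Z then 1 else (0::nat))" for Z x
  define f where "f Z z = (case z of Inl x \<Rightarrow> g Z x | Inr x \<Rightarrow> 0)" for Z and z :: "'v + 'v"
  have f_simps: "f Z (Inl x) = g Z x" "f Z (Inr x) = 0" for Z x by (simp_all add: f_def)
  have base_SN: "base x = k" if "x \<in> S \<union> N" for x using that by (simp add: base_def)
  have base_P: "base x = (if x \<in> M - C then k else k - 1)" if "x \<in> P" for x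
    using that P_H verts_H by (auto simp: base_def)
  have base_Q: "base x = (if x \<in> M - C then 1 else 0)" if "x \<in> Q" for x
    using that PQ verts_H by (auto simp: base_def)
  have base_other: "base x = 0" if "x \<notin> S" "x \<notin> N" "x \<notin> P" "x \<notin> Q" for x
    using that by (simp add: base_def)
  have A_N: "y \<in> N" if "x \<in> A" "{x, y} \<in> edges G" "y \<notin> S" for x y
  proof -
    have "x \<notin> S" using that A_G by blast
    then have "{x, y} \<in> edges ?G'" using that by (simp add: edges_del_verts[OF G])
    then show ?thesis
      using that indep_set_edgeD[OF A] by (auto simp: N_def mem_closed_nbhd[OF G'])
  qed
  have QQ: "{x, y} \<notin> edges G" if "x \<in> Q" "y \<in> Q" for x y
  proof
    assume "{x, y} \<in> edges G"
    then have "{x, y} \<in> edges H" using that PQ by (intro edge_H) auto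
    then have "{x, y} \<in> edges (del_verts H (set as))"
      using that by (auto simp: edges_del_verts[OF H] Q_def)
    then show False using as by (simp add: shedding_order_def)
  qed
  \<comment> \<open>Edges meeting \<open>S \<union> N\<close> have an end of weight at least
    \<open>k\<close>. Edges inside \<open>P\<close> have weight at least \<open>2 * (k - 1)\<close>,
    hence \<open>k\<close>, and there are none inside \<open>Q\<close>. For the remaining ones
    \<open>pq\<close> applies.\<close>
  have cover: "\<forall>e\<in>edges ?W. k \<le> (\<Sum>x\<in>e. f Z x)" if Z: "Z = X \<or> Z = Y" for Z
  proof -
    have pq': "k \<le> g Z p + g Z q" if "{p, q} \<in> edges G" "p \<in> P" "q \<in> Q" for p q
      using pq[OF that] base_P[OF that(2)] base_Q[OF that(3)] Z by (auto simp: g_def)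
    have "k \<le> g Z x + g Z y" if e: "{x, y} \<in> edges G" for x y
    proof -
      have e': "{y, x} \<in> edges G" using e by (simp add: insert_commute)
      have xy: "x \<in> verts G" "y \<in> verts G" using simple_graph_edgeD[OF G e] by auto
      show ?thesis
      proof (cases "x \<in> S \<union> N \<or> y \<in> S \<union> N")
        case True
        then show ?thesis using base_SN by (auto simp: g_def)
      next
        case False
        then have "x \<notin> A" "y \<notin> A" using A_N[OF _ e] A_N[OF _ e'] by auto
        then have "x \<in> P \<union> Q" "y \<in> P \<union> Q" using xy False verts_H PQ(2) by auto
        moreover have "k \<le> g Z x + g Z y" if "x \<in> P" "y \<in> P"
          using base_P[OF that(1)] base_P[OF that(2)] k by (auto simp: g_def)
        ultimately show ?thesis
          using pq'[OF e] pq'[OF e'] QQ e by (auto simp: add.commute)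
      qed
    qed
    then show ?thesis
      unfolding cover_add_whiskers_iff[OF G] by (simp add: f_simps g_def base_SN)
  qed
  \<comment> \<open>The two sides are not symmetric: \<open>b\<close> may be an already raised
    vertex of \<open>Y\<close>, but on \<open>X\<close> this is excluded, to keep the weights on
    \<open>Q\<close> at most 1.\<close>
  have core: "\<exists>x y. leaf_edge L x y"
    if Z: "Z = X \<or> Z = Y" and \<alpha>: "\<alpha> \<noteq> Inl b" "f Z \<alpha> > 0" and b: "b \<in> X \<union> Y" "b \<in> X \<Longrightarrow> b \<notin> Z"
      and cov: "\<And>e. e \<in> edges ?W \<Longrightarrow> k \<le> (\<Sum>z\<in>e. ((f Z)(\<alpha> := f Z \<alpha> - 1, Inl b := f Z (Inl b) + 1)) z)"
    for Z \<alpha> b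
  proof -
    obtain a where a: "\<alpha> = Inl a" using \<alpha>(2) by (cases \<alpha>) (auto simp: f_simps)
    have ab: "a \<noteq> b" and ga: "g Z a > 0" using \<alpha> a by (auto simp: f_simps)
    define g' where "g' = (g Z)(a := g Z a - 1, b := g Z b + 1)"
    have "((f Z)(\<alpha> := f Z \<alpha> - 1, Inl b := f Z (Inl b) + 1)) (Inl x) = g' x" for x
      by (simp add: a f_simps g'_def)
    moreover have "((f Z)(\<alpha> := f Z \<alpha> - 1, Inl b := f Z (Inl b) + 1)) (Inr x) = 0" for x
      by (simp add: a f_simps)
    ultimately have edge: "\<And>x y. {x, y} \<in> edges G \<Longrightarrow> k \<le> g' x + g' y" and whisker: "\<And>x. x \<in> S \<Longrightarrow> k \<le> g' x"
      using cov cover_add_whiskers_iff[OF G, of S k "(f Z)(\<alpha> := f Z \<alpha> - 1, Inl b := f Z (Inl b) + 1)"]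
      by auto
    have g'a: "g' a = g Z a - 1" using ab by (simp add: g'_def)
    have g'_eq: "g' x = base x" if "x \<noteq> a" "x \<notin> X" "x \<notin> Y" for x
      using that b(1) Z by (auto simp: g'_def g_def)
    have b_PQ: "b \<in> P \<union> Q" using b(1) XQ by blast
    have g'_Q: "g' q \<le> 1" if q: "q \<in> Q" for q
    proof -
      have "q \<notin> Y" using q XQ PQ by blast
      have "g Z q \<le> 1" using base_Q[OF q] Z XY_M \<open>q \<notin> Y\<close> by (auto simp: g_def)
      moreover have "g Z b = 0" if "q = b"
        using base_Q[OF q] b XY_M that \<open>q \<notin> Y\<close> by (auto simp: g_def)
      ultimately show ?thesis by (auto simp: g'_def)
    qed
    \<comment> \<open>The shedding order supplies a neighbour in \<open>Q\<close>, whose weight is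
      at most 1. This prevents an exchange from lowering a vertex of \<open>P\<close> below
      \<open>k - 1\<close>.\<close>
    have g'_P: "k \<le> g' p + 1" if p: "p \<in> P" for p
    proof -
      obtain q where q: "q \<in> Q" "{p, q} \<in> edges H"
        using shedding_order_neighbour[OF H as] p by (auto simp: P_def Q_def)
      then show ?thesis using edge[of p q] g'_Q[of q] edge_HG by fastforce
    qed
    \<comment> \<open>If the lowered vertex is a neighbour of \<open>C\<close>, it has a neighbour
      \<open>c\<close> in \<open>C\<close> still carrying its base weight, and the edge between them
      was covered with equality.\<close>
    have M_nbr: "\<exists>c\<in>C. {c, x} \<in> edges ?B \<and> {c, x} \<in> edges G \<and> g' c = base c \<and> c \<notin> M - C"
      if x: "x \<in> M - C" "x = a" for x
    proof -
      obtain c where c: "c \<in> C" "{c, x} \<in> edges ?B" using x mem_M by blast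
      have "c \<in> M" using c(1) mem_M by blast
      then have "c \<notin> X" "c \<notin> Y" using XY_M by auto
      moreover have "c \<noteq> a" using c(1) x by blast
      ultimately have "g' c = base c" by (intro g'_eq)
      then show ?thesis using c edge_BE[OF c(2)] by auto
    qed
    \<comment> \<open>Outside \<open>Z\<close> the weight of \<open>a\<close> is its base weight.
      Lowering it breaks a whisker, an edge to \<open>A\<close>, the bound \<open>g'_P\<close> or an
      edge to \<open>C\<close>, unless that weight was 0 already.\<close>
    have "a \<in> Z"
    proof (rule ccontr)
      assume aZ: "a \<notin> Z"
      then have ga_base: "g Z a = base a" by (simp add: g_def)
      consider "a \<in> S" | "a \<in> N" "a \<notin> S" | "a \<in> P" | "a \<in> Q" | "a \<notin> S" "a \<notin> N" "a \<notin> P" "a \<notin> Q" by blast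
      then show False
      proof cases
        case 1
        then show False using whisker[of a] g'a ga_base base_SN[of a] k by auto
      next
        case 2
        then obtain c where c: "c \<in> A" "{c, a} \<in> edges ?G'" by (auto simp: N_def mem_closed_nbhd[OF G'])
        then have "{c, a} \<in> edges G" by (simp add: del_verts_def)
        moreover have "c \<notin> S" "c \<notin> N" "c \<notin> P" "c \<notin> Q" "c \<noteq> a"
          using c(1) A_G N_G 2 verts_H PQ by auto
        then have "g' c = 0" using g'_eq[of c] base_other[of c] XQ by auto
        ultimately show False using edge[of c a] g'a ga_base base_SN[of a] 2 k by auto
      next
        case 3
        have "a \<in> M - C"
          using g'_P[OF 3] g'a ga_base base_P[OF 3] k by (auto split: if_splits)
        then obtain c where c: "c \<in> C" "{c, a} \<in> edges ?B" "{c, a} \<in> edges G" "g' c = base c" "c \<notin> M - C"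
          using M_nbr by blast
        have "c \<in> Q" using edge_BE[OF c(2)] 3 PQ by (auto simp: doubleton_eq_iff)
        then show False using edge[OF c(3)] c(4,5) base_Q[of c] g'a ga_base base_P[OF 3] k
          by (auto split: if_splits)
      next
        case 4
        have "a \<in> M - C" using ga ga_base base_Q[OF 4] by (auto split: if_splits)
        then obtain c where c: "c \<in> C" "{c, a} \<in> edges ?B" "{c, a} \<in> edges G" "g' c = base c" "c \<notin> M - C"
          using M_nbr by blast
        have "c \<in> P" using edge_BE[OF c(2)] 4 PQ by (auto simp: doubleton_eq_iff)
        then show False using edge[OF c(3)] c(4,5) base_P[of c] g'a ga_base base_Q[OF 4] k
          by (auto split: if_splits)
      next
        case 5
        then show False using ga ga_base base_other[of a] by simp
      qed
    qed
    \<comment> \<open>On an edge of \<open>L\<close> the base weights sum to \<open>k - 1\<close>,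
      and the unit from \<open>Z\<close> is gone once \<open>a\<close> is lowered. Only a raise at
      the other end restores the cover.\<close>
    have only: "e = {a, b}" if e: "e \<in> edges L" "a \<in> e" for e
    proof -
      obtain p q where pq: "p \<in> P" "q \<in> Q" "e = {p, q}" "{p, q} \<in> edges G"
        using edge_BE[of e] e edges_L by auto
      have "p \<notin> M" "q \<notin> M" using e pq edges_L by auto
      then have bs: "base p = k - 1" "base q = 0" using base_P[OF pq(1)] base_Q[OF pq(2)] by auto
      have "p \<notin> X" "q \<notin> Y" using pq XQ PQ by auto
      have "b = p \<or> b = q"
      proof (rule ccontr)
        assume nb: "\<not> ?thesis"
        consider "a = p" "Z = Y" | "a = q" "Z = X"
          using e(2) pq(3) \<open>a \<in> Z\<close> Z \<open>p \<notin> X\<close> \<open>q \<notin> Y\<close> by auto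
        then have "g' p + g' q = k - 1"
          using nb bs \<open>p \<notin> X\<close> \<open>q \<notin> Y\<close> \<open>a \<in> Z\<close> pq(1,2) PQ(1) by cases (auto simp: g'_def g_def)
        then show False using edge[OF pq(4)] k by simp
      qed
      then show ?thesis using ab e(2) pq(3) by auto
    qed
    obtain e where "e \<in> edges L" "a \<in> e" using \<open>a \<in> Z\<close> Z by (auto simp: X_def Y_def)
    then show ?thesis using only unfolding leaf_edge_def by blast
  qed
  have edge_XY: "\<exists>x y. x \<in> X \<and> y \<in> Y"
  proof -
    obtain e where e: "e \<in> edges L" using ne by blast
    then obtain p q where "p \<in> P" "q \<in> Q" "e = {p, q}" using edge_BE[of e] edges_L by auto
    then have "q \<in> X" "p \<in> Y" using e by (auto simp: X_def Y_def)
    then show ?thesis by blast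
  qed
  then obtain x0 y0 where x0: "x0 \<in> X" and y0: "y0 \<in> Y" by blast
  have XY_G: "X \<subseteq> verts G" "Y \<subseteq> verts G" using XQ PQ verts_H by auto
  have sum_f: "(\<Sum>z\<in>verts ?W. f Z z) = (\<Sum>x\<in>verts G. base x) + card Z" if "Z \<subseteq> verts G" for Z
  proof -
    have finS: "finite S" using S fin by (rule finite_subset)
    have "(\<Sum>z\<in>verts ?W. f Z z) = (\<Sum>z\<in>Inl ` verts G. f Z z) + (\<Sum>z\<in>Inr ` S. f Z z)"
      unfolding add_whiskers_def using fin finS by (simp, intro sum.union_disjoint) auto
    also have "\<dots> = (\<Sum>x\<in>verts G. g Z x)" by (simp add: sum.reindex f_simps)
    also have "\<dots> = (\<Sum>x\<in>verts G. base x) + card (verts G \<inter> Z)"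
      using fin by (simp add: g_def sum.distrib sum.If_cases Int_def)
    finally show ?thesis using that by (simp add: Int_absorb1)
  qed
  \<comment> \<open>Exchange needs equal total weight, so the cover from the smaller side is padded
    by \<open>n\<close> at \<open>y0\<close>. This vertex lies in \<open>Y\<close>, where large
    weights do no harm.\<close>
  have exchange: "\<exists>x y. leaf_edge L x y"
    if ZZ: "Z = X \<and> Z' = Y \<or> Z = Y \<and> Z' = X" and card: "card Z = card Z' + n" for Z Z' n
  proof -
    let ?v = "(f Z')(Inl y0 := f Z' (Inl y0) + n)"
    have Z: "Z = X \<or> Z = Y" "Z' = X \<or> Z' = Y" "Z \<subseteq> verts G" "Z' \<subseteq> verts G" "Z \<inter> Z' = {}"
      using ZZ XY_G XY by auto
    have y0W: "Inl y0 \<in> verts ?W" using y0 XY_G by (auto simp: add_whiskers_def)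
    have finW: "finite (verts ?W)" using simple_graph_add_whiskers[OF G S] by (simp add: simple_graph_def)
    have f_le: "f Z' z \<le> ?v z" for z by simp
    have supp: "f Z z = 0 \<and> ?v z = 0" if "z \<notin> verts ?W" for z
    proof -
      have "x \<notin> S" "x \<notin> N" "x \<notin> P" "x \<notin> Q" "x \<notin> Z" "x \<notin> Z'" if "x \<notin> verts G" for x
        using that S N_G verts_H PQ Z(3,4) by auto
      then have "g Z x = 0 \<and> g Z' x = 0" if "x \<notin> verts G" for x
        using that base_other[of x] by (simp add: g_def)
      moreover have "z \<noteq> Inl y0" using that y0W by blast
      ultimately show ?thesis using that by (cases z) (auto simp: f_simps add_whiskers_def)
    qed
    have cov_v: "k \<le> (\<Sum>z\<in>e. ?v z)" if "e \<in> edges ?W" for e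
      using cover[OF Z(2)] that sum_mono[of e "f Z'" ?v] f_le by (meson order_trans)
    have "(\<Sum>z\<in>verts ?W. ?v z) = (\<Sum>z\<in>verts ?W. f Z' z + (if z = Inl y0 then n else 0))"
      by (intro sum.cong) auto
    also have "\<dots> = (\<Sum>z\<in>verts ?W. f Z z)"
      using sum_f[OF Z(3)] sum_f[OF Z(4)] card y0W finW by (simp add: sum.distrib)
    finally have deg: "(\<Sum>z\<in>verts ?W. f Z z) = (\<Sum>z\<in>verts ?W. ?v z)" ..
    obtain z where "z \<in> Z'" using ZZ x0 y0 by blast
    then have "f Z (Inl z) < ?v (Inl z)" using Z(5) by (auto simp: f_simps g_def)
    then have neq: "f Z \<noteq> ?v" by (metis less_irrefl)
    obtain \<alpha> \<beta> where \<alpha>: "\<alpha> \<noteq> \<beta>" "f Z \<alpha> > 0" "f Z \<beta> < ?v \<beta>"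
      and cov: "\<And>e. e \<in> edges ?W \<Longrightarrow> k \<le> (\<Sum>z\<in>e. ((f Z)(\<alpha> := f Z \<alpha> - 1, \<beta> := f Z \<beta> + 1)) z)"
      using componentwise_linear_cover_exchange[OF simple_graph_add_whiskers[OF G S] lin supp _ cov_v deg neq]
        cover[OF Z(1)] by blast
    obtain b where b: "\<beta> = Inl b" using \<alpha>(3) by (cases \<beta>) (auto simp: f_simps)
    have b_mem: "b \<in> Z' \<and> b \<notin> Z \<or> b = y0"
      using \<alpha>(3) b Z(5) by (auto simp: f_simps g_def split: if_splits)
    show ?thesis
    proof (rule core[OF Z(1) \<alpha>(1)[unfolded b] \<alpha>(2) _ _ cov[unfolded b]])
      show "b \<in> X \<union> Y" using b_mem ZZ y0 by auto
      show "b \<notin> Z" if "b \<in> X" using b_mem y0 that XY by auto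
    qed
  qed
  show ?thesis
  proof (cases "card X \<le> card Y")
    case True
    then show ?thesis using exchange[of Y X "card Y - card X"] by simp
  next
    case False
    then show ?thesis using exchange[of X Y "card X - card Y"] by simp
  qed
qed

text \<open>Together with \<open>A\<close>, all whisker vertices form an independent set. Its closed
  neighbourhood contains the whiskers, \<open>S\<close> and the closed neighbourhood of
  \<open>A\<close> outside \<open>S\<close>, so its link is a copy of the graph in question.\<close>

lemma vertex_decomposable_whisker_link:
  assumes G: "simple_graph G" and S: "S \<subseteq> verts G"
    and W: "vertex_decomposable (add_whiskers G S)" and A: "indep_set (del_verts G S) A"
  shows "vertex_decomposable (del_verts (del_verts G S) (closed_nbhd (del_verts G S) A))"
proof -
  let ?W = "add_whiskers G S" and ?G' = "del_verts G S"
  let ?A = "Inl ` A \<union> Inr ` S"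
  have W': "simple_graph ?W" using G S by (rule simple_graph_add_whiskers)
  have G': "simple_graph ?G'" using G by (rule simple_graph_del_verts)
  have A_G: "A \<subseteq> verts G" "A \<inter> S = {}" "indep_set G A"
    using A unfolding indep_set_del_verts by (auto simp: indep_set_def)
  have edge: "{Inl x, Inl y} \<in> edges ?W \<longleftrightarrow> {x, y} \<in> edges G"
    "{Inr s, Inl y} \<in> edges ?W \<longleftrightarrow> s = y \<and> s \<in> S"
    "{Inl x, Inr s} \<in> edges ?W \<longleftrightarrow> s = x \<and> s \<in> S"
    "{Inr s, Inr t} \<notin> edges ?W" for x y s t
  proof -
    have img: "{Inl x, Inl y} = Inl ` e \<longleftrightarrow> e = {x, y}" for e :: "'a set"
      using inj_image_eq_iff[of Inl "{x, y}" e] by auto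
    have "Inr s \<notin> Inl ` e" for e :: "'a set" and s :: 'a by auto
    then have img': "{Inr s, z} \<noteq> Inl ` e" "{z, Inr s} \<noteq> Inl ` e" for e :: "'a set" and z and s :: 'a by auto
    show "{Inl x, Inl y} \<in> edges ?W \<longleftrightarrow> {x, y} \<in> edges G"
      by (auto simp: add_whiskers_def img doubleton_eq_iff)
    show "{Inr s, Inl y} \<in> edges ?W \<longleftrightarrow> s = y \<and> s \<in> S"
      "{Inl x, Inr s} \<in> edges ?W \<longleftrightarrow> s = x \<and> s \<in> S"
      "{Inr s, Inr t} \<notin> edges ?W"
      by (auto simp: add_whiskers_def img' doubleton_eq_iff)
  qed
  have "indep_set ?W ?A"
    unfolding indep_set_def
  proof (intro conjI ballI notI)
    show "?A \<subseteq> verts ?W" using A_G by (auto simp: add_whiskers_def)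
    fix e assume e: "e \<in> edges ?W" "e \<subseteq> ?A"
    obtain x y where "e = {x, y}" by (rule simple_graph_edgeE[OF W' e(1)])
    then show False
      using e A_G indep_set_edgeD[OF A_G(3)] by (cases x; cases y) (auto simp: edge)
  qed
  with W W' have "vertex_decomposable (del_verts ?W (closed_nbhd ?W ?A))"
    by (rule vertex_decomposable_link)
  moreover have "del_verts ?W (closed_nbhd ?W ?A) = map_graph Inl (del_verts ?G' (closed_nbhd ?G' A))"
  proof -
    have nb: "Inl v \<in> closed_nbhd ?W ?A \<longleftrightarrow> v \<in> S \<or> v \<in> closed_nbhd ?G' A" for v
    proof -
      have "{a, v} \<in> edges ?G' \<longleftrightarrow> {a, v} \<in> edges G \<and> v \<notin> S" if "a \<in> A" for a
        using that A_G by (auto simp: edges_del_verts[OF G])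
      then have "v \<in> closed_nbhd ?G' A \<longleftrightarrow> v \<in> A \<or> v \<notin> S \<and> (\<exists>a\<in>A. {a, v} \<in> edges G)"
        by (auto simp: mem_closed_nbhd[OF G'])
      moreover have "(\<exists>a\<in>?A. {a, Inl v} \<in> edges ?W) \<longleftrightarrow> (\<exists>a\<in>A. {a, v} \<in> edges G) \<or> v \<in> S"
        by (simp add: bex_Un edge)
      ultimately show ?thesis
        unfolding mem_closed_nbhd[OF W'] by auto
    qed
    have nb': "Inr s \<in> closed_nbhd ?W ?A" if "s \<in> S" for s
      using that by (simp add: closed_nbhd_def)
    have "verts (del_verts ?W (closed_nbhd ?W ?A)) = verts (map_graph Inl (del_verts ?G' (closed_nbhd ?G' A)))"
      using nb nb' by (auto simp: map_graph_def del_verts_def[of ?W] del_verts_def[of ?G'] add_whiskers_def)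
        (auto simp: del_verts_def)
    moreover have "edges (del_verts ?W (closed_nbhd ?W ?A)) = edges (map_graph Inl (del_verts ?G' (closed_nbhd ?G' A)))"
    proof -
      define T where "T = closed_nbhd ?W ?A"
      have disj: "Inl ` e \<inter> T = {} \<longleftrightarrow> e \<inter> S = {} \<and> e \<inter> closed_nbhd ?G' A = {}" for e
        unfolding T_def using nb by (auto simp: disjoint_iff)
      have "Inr s \<in> T" if "s \<in> S" for s
        unfolding T_def using that by (rule nb')
      then have "{e \<in> edges ?W. e \<inter> T = {}} = (`) Inl ` {e \<in> edges G. Inl ` e \<inter> T = {}}"
        by (auto simp: add_whiskers_def)
      also have "\<dots> = edges (map_graph Inl (del_verts ?G' (closed_nbhd ?G' A)))"
        unfolding disj by (simp add: map_graph_def edges_del_verts[OF G'] edges_del_verts[OF G])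
      finally show ?thesis unfolding edges_del_verts[OF W'] T_def .
    qed
    ultimately show ?thesis by (intro sgraph.equality) auto
  qed
  ultimately show ?thesis using vertex_decomposable_map_graphD[of Inl] by simp
qed

theorem corollary3p9:
  fixes G :: "'v sgraph" and S :: "'v set" and k :: nat
    and shed_ord :: "'v sgraph \<Rightarrow> 'v list"
  assumes "simple_graph G" and "S \<subseteq> verts G"
    and "vertex_decomposable (add_whiskers G S)"
    and shed_ord: "\<forall>H. simple_graph H \<and> vertex_decomposable H \<longrightarrow> shedding_order H (shed_ord H)"
    and "\<exists>A. indep_set (del_verts G S) A \<and>
           (let H = del_verts (del_verts G S) (closed_nbhd (del_verts G S) A)
            in \<not> vertex_decomposable (bip_graph H (shed_ord H)))"
    and "k \<ge> 2"
  shows "\<not> componentwise_linear (verts (add_whiskers G S))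
           (cover_ideal_symbolic_power (add_whiskers G S) k :: ('v + 'v, 'k::field) mpoly set)"
proof
  assume lin: "componentwise_linear (verts (add_whiskers G S))
           (cover_ideal_symbolic_power (add_whiskers G S) k :: ('v + 'v, 'k::field) mpoly set)"
  obtain A where A: "indep_set (del_verts G S) A"
    and not_vd: "\<not> vertex_decomposable (bip_graph (del_verts (del_verts G S) (closed_nbhd (del_verts G S) A))
      (shed_ord (del_verts (del_verts G S) (closed_nbhd (del_verts G S) A))))"
    using assms(5) unfolding Let_def by blast
  let ?H = "del_verts (del_verts G S) (closed_nbhd (del_verts G S) A)"
  have H: "simple_graph ?H" using assms(1) by (intro simple_graph_del_verts)
  \<comment> \<open>The chosen order is a shedding order only for vertex decomposable graphs, so
    \<open>?H\<close> must first be recognised as one.\<close>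
  have as: "shedding_order ?H (shed_ord ?H)"
    using shed_ord H vertex_decomposable_whisker_link[OF assms(1-3) A] by blast
  have "simple_graph (bip_graph ?H (shed_ord ?H))"
    using H by (auto simp: simple_graph_def bip_graph_def)
  then have "vertex_decomposable (bip_graph ?H (shed_ord ?H))"
    by (rule vertex_decomposable_if_leaves)
      (rule leaf_edge_bip_graph_link[OF assms(1,2,6) lin A as])
  with not_vd show False ..
qed

end
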